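(* Let $k$ be a positive integer and let $A$ be any node of the dense Gaussian network $G_k$, written in its canonical representative $A=(a_x,a_y)\in D_k$. Then the exact number of valid new sources with respect to $0$ and $A$ in $G_k$, namely $\operatorname{count}(A,k)=|\{P\in G_k : d(0,P)=k,\ d(A,P)=k\}|$, is $$\operatorname{count}(A,k)=\sum_{i=1}^{4}\left|\bigcup_{L\in\mathcal L_k}\bigcup_{j=1}^{4}T_{ij}(A,L)\right|.$$ The formula uses a fixed number (independent of $k$) of side-pair interval computations, and therefore gives an $O(1)$ counting procedure with respect to $k$ and $N=k^2+(k+1)^2$.
   Context: Dense Gaussian network: for a positive integer $k$, $G_k$ is the graph whose nodes are the elements of $\mathbb Z[i]/(k+(k+1)i)$, equivalently $\mathbb Z^2$ modulo the lattice generated by $e_1=(k,k+1)$ and $e_2=(-(k+1),k)$, where $(x,y)$ stands for $x+yi$; two nodes are adjacent iff they differ by $\pm1$ or $\pm i$. It has $N=k^2+(k+1)^2$ nodes and diameter $k$. Let $D_k=\{(x,y)\in\mathbb Z^2:|x|+|y|\le k\}$ and $\partial D_k=\{(x,y)\in\mathbb Z^2:|x|+|y|=k\}$; $D_k$ is the set of canonical representatives of the nodes, and each node is identified with its representative in $D_k$ (the equivalent representative of minimum Manhattan length). $d$ denotes graph distance in $G_k$; $d(U,V)=|x|+|y|$ where $(x,y)\in D_k$ is the canonical representative of $U-V$. Shift set: $\mathcal L_k=\{m e_1+n e_2 : m,n\in\{-1,0,1\}\}\subset\mathbb Z^2$. Sides: $\partial D_k$ is partitioned into four sides $S_i=\{P_i(t):t\in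 R_i\}$, where the parameter ranges $R_i$ are sets of integers: $P_1(t)=(t,k-t)$, $R_1=\{t\in\mathbb Z:0\le t\le k\}$; $P_2(t)=(-t,k-t)$, $R_2=\{t\in\mathbb Z:1\le t\le k\}$; $P_3(t)=(-t,-k+t)$, $R_3=\{t\in\mathbb Z:0\le t\le k-1\}$; $P_4(t)=(t,-k+t)$, $R_4=\{t\in\mathbb Z:1\le t\le k-1\}$. For $L\in\mathcal L_k$ and $i,j\in\{1,2,3,4\}$, $$T_{ij}(A,L)=\{t\in R_i : P_i(t)=A+L+P_j(u)\text{ in }\mathbb Z^2\text{ for some }u\in R_j\}.$$ A side-pair interval computation is the determination of one set $T_{ij}(A,L)$ (which is empty, a single integer, or an integer interval) by solving the two linear equations $P_i(t)=A+L+P_j(u)$ in $t,u$ with the range restrictions; for each $i$ the resulting intervals are merged before counting. Running time is in the word-RAM model, where arithmetic on node coordinates takes constant time. *)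

theory Defs
  imports Main "HOL-Library.Product_Plus"
begin

section \<open>Dense Gaussian networks\<close>

text \<open>The pair \<open>(x, y)\<close> stands for the Gaussian integer \<open>x + y i\<close>.\<close>

definition shift :: "nat \<Rightarrow> int \<Rightarrow> int \<Rightarrow> int \<times> int" where
  \<comment> \<open>\<open>m e\<^sub>1 + n e\<^sub>2\<close> for \<open>e\<^sub>1 = (k, k + 1)\<close> and \<open>e\<^sub>2 = (-(k + 1), k)\<close>\<close>
  "shift k m n = (m * int k - n * (int k + 1), m * (int k + 1) + n * int k)"

definition lattice :: "nat \<Rightarrow> (int \<times> int) set" where
  "lattice k = {shift k m n | m n. True}"

definition lattice_rel :: "nat \<Rightarrow> ((int \<times> int) \<times> (int \<times> int)) set" where
  "lattice_rel k = {(U, V). U - V \<in> lattice k}"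

definition nodes :: "nat \<Rightarrow> (int \<times> int) set set" where
  "nodes k = UNIV // lattice_rel k"

definition node :: "nat \<Rightarrow> int \<times> int \<Rightarrow> (int \<times> int) set" where
  "node k U = lattice_rel k `` {U}"

definition adjacent :: "nat \<Rightarrow> (int \<times> int) set \<Rightarrow> (int \<times> int) set \<Rightarrow> bool" where
  "adjacent k u v \<longleftrightarrow> u \<in> nodes k \<and> v \<in> nodes k \<and>
     (\<exists>U\<in>u. \<exists>V\<in>v. V - U \<in> {(1, 0), (-1, 0), (0, 1), (0, -1)})"

definition graph_dist :: "nat \<Rightarrow> (int \<times> int) set \<Rightarrow> (int \<times> int) set \<Rightarrow> nat" where
  "graph_dist k u v = (LEAST n. (adjacent k ^^ n) u v)"

definition network_order :: "nat \<Rightarrow> nat" where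
  "network_order k = k\<^sup>2 + (k + 1)\<^sup>2"

definition diamond :: "nat \<Rightarrow> (int \<times> int) set" where
  "diamond k = {(x, y). \<bar>x\<bar> + \<bar>y\<bar> \<le> int k}"

definition source_count :: "int \<times> int \<Rightarrow> nat \<Rightarrow> nat" where
  "source_count A k = card {P \<in> nodes k.
     graph_dist k (node k 0) P = k \<and> graph_dist k (node k A) P = k}"

section \<open>Sides of the boundary\<close>

definition shift_set :: "nat \<Rightarrow> (int \<times> int) set" where
  "shift_set k = {shift k m n | m n. m \<in> {-1, 0, 1} \<and> n \<in> {-1, 0, 1}}"

text \<open>Sides are numbered 1 to 4; other indices are never used.\<close>

definition side_point :: "nat \<Rightarrow> nat \<Rightarrow> int \<Rightarrow> int \<times> int" where
  "side_point k i t =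
     (if i = 1 then (t, int k - t)
      else if i = 2 then (- t, int k - t)
      else if i = 3 then (- t, - int k + t)
      else (t, - int k + t))"

definition side_range :: "nat \<Rightarrow> nat \<Rightarrow> int set" where
  "side_range k i =
     (if i = 1 then {0..int k}
      else if i = 2 then {1..int k}
      else if i = 3 then {0..int k - 1}
      else {1..int k - 1})"

definition side_pair_set :: "nat \<Rightarrow> nat \<Rightarrow> nat \<Rightarrow> int \<times> int \<Rightarrow> int \<times> int \<Rightarrow> int set" where
  "side_pair_set k i j A L =
     {t \<in> side_range k i. \<exists>u\<in>side_range k j. side_point k i t = A + L + side_point k j u}"

section \<open>A word RAM\<close>

text \<open>
  Every instruction costs one step.  Memory cells hold signed words of \<open>w\<close> bits; an instruction
  whose result does not fit into a word, or that uses a negative address, has no successor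
  state, so a halting run never leaves the range of the word length.  The first operand of an
  instruction is its destination, except in \<open>Store\<close>, where it is the cell holding the address,
  and in the jump.  Division is floor division.
\<close>

datatype instr =
    Const nat int
  | Copy nat nat
  | Load nat nat
  | Store nat nat
  | Add nat nat nat
  | Sub nat nat nat
  | Mult nat nat nat
  | Div nat nat nat
  | Mod nat nat nat
  | Less nat nat nat
  | Jump_Less nat nat nat

type_synonym program = "instr list"
type_synonym memory = "nat \<Rightarrow> int"

definition fits :: "nat \<Rightarrow> int \<Rightarrow> bool" where
  "fits w v \<longleftrightarrow> - (2 ^ w) \<le> 2 * v \<and> 2 * v < 2 ^ w"

fun address_ok :: "instr \<Rightarrow> memory \<Rightarrow> bool" where
  "address_ok (Load a b) M \<longleftrightarrow> 0 \<le> M b"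
| "address_ok (Store a b) M \<longleftrightarrow> 0 \<le> M a"
| "address_ok _ M \<longleftrightarrow> True"

fun effect :: "instr \<Rightarrow> nat \<times> memory \<Rightarrow> nat \<times> memory" where
  "effect (Const a v) (pc, M) = (Suc pc, M(a := v))"
| "effect (Copy a b) (pc, M) = (Suc pc, M(a := M b))"
| "effect (Load a b) (pc, M) = (Suc pc, M(a := M (nat (M b))))"
| "effect (Store a b) (pc, M) = (Suc pc, M(nat (M a) := M b))"
| "effect (Add a b c) (pc, M) = (Suc pc, M(a := M b + M c))"
| "effect (Sub a b c) (pc, M) = (Suc pc, M(a := M b - M c))"
| "effect (Mult a b c) (pc, M) = (Suc pc, M(a := M b * M c))"
| "effect (Div a b c) (pc, M) = (Suc pc, M(a := M b div M c))"
| "effect (Mod a b c) (pc, M) = (Suc pc, M(a := M b mod M c))"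
| "effect (Less a b c) (pc, M) = (Suc pc, M(a := (if M b < M c then 1 else 0)))"
| "effect (Jump_Less b c l) (pc, M) = ((if M b < M c then l else Suc pc), M)"

definition ram_step :: "nat \<Rightarrow> program \<Rightarrow> nat \<times> memory \<Rightarrow> nat \<times> memory \<Rightarrow> bool" where
  "ram_step w p s s' \<longleftrightarrow> fst s < length p \<and> address_ok (p ! fst s) (snd s) \<and>
     s' = effect (p ! fst s) s \<and> (\<forall>a. fits w (snd s' a))"

text \<open>Started on memory \<open>M\<close>, the program \<open>p\<close> halts after exactly \<open>t\<close> steps with memory \<open>M'\<close>.\<close>

definition ram_halts :: "nat \<Rightarrow> program \<Rightarrow> memory \<Rightarrow> nat \<Rightarrow> memory \<Rightarrow> bool" where
  "ram_halts w p M t M' \<longleftrightarrow> (\<forall>a. fits w (M a)) \<and>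
     (\<exists>pc. (ram_step w p ^^ t) (0, M) (pc, M') \<and> length p \<le> pc)"

section \<open>Side-pair interval computations\<close>

text \<open>
  A side-pair interval computation is a program that determines one set \<open>T\<^sub>i\<^sub>j(A, L)\<close>, where
  \<open>L = m e\<^sub>1 + n e\<^sub>2\<close> and \<open>pair_index = (i, j, m, n)\<close>, by leaving the end points of an integer
  interval in the cells \<open>lo_cell\<close> and \<open>hi_cell\<close>; the empty set is given by end points in the
  wrong order, and a single integer by equal end points.
\<close>

datatype side_pair_comp = Side_Pair_Comp
  (pair_index: "nat \<times> nat \<times> int \<times> int")
  (pair_program: program)
  (lo_cell: nat)
  (hi_cell: nat)

definition determines :: "nat \<Rightarrow> int \<times> int \<Rightarrow> side_pair_comp \<Rightarrow> memory \<Rightarrow> bool" where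
  "determines k A q M \<longleftrightarrow> (case pair_index q of (i, j, m, n) \<Rightarrow>
     side_pair_set k i j A (shift k m n) = {M (lo_cell q)..M (hi_cell q)})"

text \<open>The computations are performed one after the other on the same memory, in \<open>t\<close> steps overall.\<close>

fun run_comps ::
  "nat \<Rightarrow> nat \<Rightarrow> int \<times> int \<Rightarrow> side_pair_comp list \<Rightarrow> memory \<Rightarrow> nat \<Rightarrow> memory \<Rightarrow> bool" where
  "run_comps w k A [] M t M' \<longleftrightarrow> t = 0 \<and> M' = M"
| "run_comps w k A (q # qs) M t M' \<longleftrightarrow>
     (\<exists>t\<^sub>1 t\<^sub>2 M\<^sub>1. ram_halts w (pair_program q) M t\<^sub>1 M\<^sub>1 \<and> determines k A q M\<^sub>1 \<and>
        run_comps w k A qs M\<^sub>1 t\<^sub>2 M' \<and> t = t\<^sub>1 + t\<^sub>2)"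

definition input_memory :: "nat \<Rightarrow> int \<times> int \<Rightarrow> memory" where
  "input_memory k A = (\<lambda>_. 0)(0 := int k, 1 := fst A, 2 := snd A)"

end

theory Submission
  imports Defs
begin

text \<open>
  The \<open>l\<^sub>1\<close> norm of a nonzero lattice vector exceeds \<open>2 k\<close>, so a node has at most one
  representative in \<open>D\<^sub>k\<close>, and the nodes at distance \<open>k\<close> from \<open>U\<close> are exactly the classes of
  \<open>U + Q\<close> with \<open>Q\<close> on the boundary.  Hence the new sources are the boundary points
  \<open>P = A + L + Q\<close> with \<open>L\<close> in the lattice; as \<open>L\<close> has norm at most \<open>3 k\<close>, it lies in the shift
  set.  Uniqueness of representatives also makes the sets \<open>T\<^sub>i\<^sub>j(A, L)\<close> for fixed \<open>i\<close> pairwise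
  disjoint, so merging them is adding lengths.  The end points of the intervals and the sums of
  their lengths are fixed arithmetic expressions in \<open>k\<close> and \<open>A\<close>, which compile to jump-free
  programs; each intermediate result is bounded by a fixed power of the network order.
\<close>

section \<open>Norms of lattice vectors and uniqueness of representatives\<close>

definition l1 :: "int \<times> int \<Rightarrow> int" where
  "l1 P = \<bar>fst P\<bar> + \<bar>snd P\<bar>"

definition boundary :: "nat \<Rightarrow> (int \<times> int) set" where
  "boundary k = {P. l1 P = int k}"

lemma l1_diff_le: "l1 (P - Q) \<le> l1 P + l1 Q"
  by (simp add: l1_def)

lemma mem_diamond_iff: "A \<in> diamond k \<longleftrightarrow> l1 A \<le> int k"
  by (cases A) (simp add: diamond_def l1_def)

lemma shift_0 [simp]: "shift k 0 0 = 0"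
  by (simp add: shift_def zero_prod_def)

lemma shift_diff: "shift k m n - shift k m' n' = shift k (m - m') (n - n')"
  by (simp add: shift_def algebra_simps)

lemma lattice_zero: "0 \<in> lattice k"
  unfolding lattice_def using shift_0 by (metis (mono_tags, lifting) mem_Collect_eq)

lemma lattice_diff: "U \<in> lattice k \<Longrightarrow> V \<in> lattice k \<Longrightarrow> U - V \<in> lattice k"
  unfolding lattice_def using shift_diff by blast

lemma lattice_minus: "U \<in> lattice k \<Longrightarrow> - U \<in> lattice k"
  using lattice_diff[OF lattice_zero] by simp

lemma lattice_add: "U \<in> lattice k \<Longrightarrow> V \<in> lattice k \<Longrightarrow> U + V \<in> lattice k"
  using lattice_diff[of U k "- V"] lattice_minus by simp

text \<open>The norm is \<open>max \<bar>x + y\<bar> \<bar>x - y\<bar>\<close>, and on \<open>m e\<^sub>1 + n e\<^sub>2\<close> these two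
  coordinates are \<open>m (2k + 1) - n\<close> and \<open>- m - n (2k + 1)\<close>.\<close>

lemma l1_shift_ge:
  "\<bar>m * (2 * int k + 1) - n\<bar> \<le> l1 (shift k m n)"
  "\<bar>m + n * (2 * int k + 1)\<bar> \<le> l1 (shift k m n)"
proof -
  have "m * (2 * int k + 1) - n = fst (shift k m n) + snd (shift k m n)"
    "m + n * (2 * int k + 1) = snd (shift k m n) - fst (shift k m n)"
    by (simp_all add: shift_def algebra_simps)
  then show "\<bar>m * (2 * int k + 1) - n\<bar> \<le> l1 (shift k m n)"
    "\<bar>m + n * (2 * int k + 1)\<bar> \<le> l1 (shift k m n)"
    by (simp_all add: l1_def)
qed

text \<open>The multiple of \<open>2 k + 1\<close> dominates, and the other coefficient takes away
  at most its absolute value. The two sign patterns serve the two coordinates of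
  \<open>shift k m n\<close>, the second with \<open>m\<close> and \<open>n\<close>
  exchanged.\<close>

lemma abs_mult_diff_ge:
  fixes m n :: int
  assumes "\<bar>n\<bar> \<le> \<bar>m\<bar>"
  shows "2 * int k * \<bar>m\<bar> + (\<bar>m\<bar> - \<bar>n\<bar>) \<le> \<bar>m * (2 * int k + 1) - n\<bar>"
    "2 * int k * \<bar>m\<bar> + (\<bar>m\<bar> - \<bar>n\<bar>) \<le> \<bar>n + m * (2 * int k + 1)\<bar>"
proof -
  have "\<bar>m * (2 * int k + 1)\<bar> = 2 * int k * \<bar>m\<bar> + \<bar>m\<bar>"
    unfolding abs_mult by (simp add: algebra_simps abs_of_nonneg)
  then show "2 * int k * \<bar>m\<bar> + (\<bar>m\<bar> - \<bar>n\<bar>) \<le> \<bar>m * (2 * int k + 1) - n\<bar>"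
    "2 * int k * \<bar>m\<bar> + (\<bar>m\<bar> - \<bar>n\<bar>) \<le> \<bar>n + m * (2 * int k + 1)\<bar>"
    by linarith+
qed

lemma l1_shift_ge_max: "2 * int k * max \<bar>m\<bar> \<bar>n\<bar> \<le> l1 (shift k m n)"
  using l1_shift_ge(1)[of m k n] l1_shift_ge(2)[of m n k] abs_mult_diff_ge(1)[of n m k] abs_mult_diff_ge(2)[of m n k]
  by (cases "\<bar>n\<bar> \<le> \<bar>m\<bar>") (auto simp: max_def)

text \<open>If \<open>m\<close> and \<open>n\<close> have equal absolute values, their terms
  reinforce each other in one of the two coordinates, which gives a multiple of
  \<open>2 k + 2\<close>. Otherwise the larger one is nonzero and exceeds the smaller by at least 1,
  and this excess makes the bound strict.\<close>

lemma l1_shift_gt: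
  assumes "(m, n) \<noteq> (0, 0)"
  shows "2 * int k < l1 (shift k m n)"
proof (cases "\<bar>m\<bar> = \<bar>n\<bar>")
  case True
  then have "m \<noteq> 0" using assms by auto
  have "n = m \<or> n = - m" using True by linarith
  then have "\<bar>m\<bar> * (2 * int k + 2) \<le> l1 (shift k m n)"
  proof
    assume "n = m"
    then have "m + n * (2 * int k + 1) = m * (2 * int k + 2)" by (simp add: algebra_simps)
    then show ?thesis using l1_shift_ge(2)[of m n k] by (simp add: abs_mult)
  next
    assume "n = - m"
    then have "m * (2 * int k + 1) - n = m * (2 * int k + 2)" by (simp add: algebra_simps)
    then show ?thesis using l1_shift_ge(1)[of m k n] by (simp add: abs_mult)
  qed
  moreover have "1 * (2 * int k + 2) \<le> \<bar>m\<bar> * (2 * int k + 2)"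
    using \<open>m \<noteq> 0\<close> by (intro mult_right_mono) auto
  ultimately have "1 * (2 * int k + 2) \<le> l1 (shift k m n)" by (rule order_trans[rotated])
  then show ?thesis by simp
next
  case False
  have *: "2 * int k * 1 \<le> 2 * int k * \<bar>x\<bar>" if "x \<noteq> 0" for x :: int
    using that by (intro mult_left_mono) auto
  show ?thesis
  proof (cases "\<bar>n\<bar> < \<bar>m\<bar>")
    case True
    then show ?thesis
      using l1_shift_ge(1)[of m k n] abs_mult_diff_ge(1)[of n m k] *[of m] by linarith
  next
    case F: False
    with False have "\<bar>m\<bar> < \<bar>n\<bar>" by linarith
    then show ?thesis
      using l1_shift_ge(2)[of m n k] abs_mult_diff_ge(2)[of m n k] *[of n] by linarith
  qed
qed

lemma shift_inj: "shift k m n = shift k m' n' \<longleftrightarrow> m = m' \<and> n = n'"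
proof
  assume "shift k m n = shift k m' n'"
  then have "shift k (m - m') (n - n') = 0" using shift_diff[of k m n m' n'] by simp
  then show "m = m' \<and> n = n'" using l1_shift_gt[of "m - m'" "n - n'" k] by (auto simp: l1_def)
qed auto

text \<open>By the triangle inequality the difference has norm at most \<open>2 k\<close>, which no
  nonzero lattice vector attains.\<close>

lemma l1_lattice_le_eq:
  assumes "P - Q \<in> lattice k" "l1 P \<le> int k" "l1 Q \<le> int k"
  shows "P = Q"
proof -
  obtain m n where mn: "P - Q = shift k m n" using assms(1) by (auto simp: lattice_def)
  have "l1 (shift k m n) \<le> 2 * int k" using l1_diff_le[of P Q] assms mn by simp
  then have "(m, n) = (0, 0)" using l1_shift_gt[of m n k] by linarith
  then show ?thesis using mn by simp
qed

text \<open>A coefficient of absolute value 2 or more forces the norm up to \<open>4 k\<close>,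
  which exceeds \<open>3 k\<close> because \<open>k\<close> is positive.\<close>

lemma mem_shift_setI:
  assumes "L \<in> lattice k" "l1 L \<le> 3 * int k" "0 < k"
  shows "L \<in> shift_set k"
proof -
  obtain m n where mn: "L = shift k m n" using assms(1) by (auto simp: lattice_def)
  have "max \<bar>m\<bar> \<bar>n\<bar> \<le> 1"
  proof (rule ccontr)
    assume "\<not> ?thesis"
    then have "2 * int k * 2 \<le> 2 * int k * max \<bar>m\<bar> \<bar>n\<bar>" by (intro mult_left_mono) auto
    then have "2 * int k * 2 \<le> l1 (shift k m n)" using l1_shift_ge_max by (rule order_trans)
    then have "4 * int k \<le> l1 (shift k m n)" by simp
    then show False using assms(2,3) unfolding mn by linarith
  qed
  then have "m \<in> {-1, 0, 1}" "n \<in> {-1, 0, 1}" by auto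
  then show ?thesis unfolding shift_set_def mn by blast
qed

lemma shift_set_subset_lattice: "shift_set k \<subseteq> lattice k"
  by (auto simp: shift_set_def lattice_def)

lemma shift_set_image: "shift_set k = (\<lambda>(m, n). shift k m n) ` ({-1, 0, 1} \<times> {-1, 0, 1})"
  unfolding shift_set_def by force

lemma inj_shift: "inj_on (\<lambda>(m, n). shift k m n) S"
  by (auto simp: inj_on_def shift_inj)

lemma card_shift_set: "card (shift_set k) = 9"
  unfolding shift_set_image by (subst card_image[OF inj_shift]) (simp add: card_cartesian_product)

section \<open>Distances in the network\<close>

lemma mem_node_iff: "V \<in> node k U \<longleftrightarrow> U - V \<in> lattice k"
  by (simp add: node_def lattice_rel_def)

lemma node_eq_iff: "node k U = node k V \<longleftrightarrow> U - V \<in> lattice k"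
proof
  assume "node k U = node k V"
  then show "U - V \<in> lattice k"
    using mem_node_iff[of V k V] mem_node_iff[of V k U] lattice_zero by simp
next
  assume UV: "U - V \<in> lattice k"
  show "node k U = node k V"
  proof (intro set_eqI)
    fix W
    have "U - W = (U - V) + (V - W)" "V - W = (U - W) - (U - V)" by simp_all
    then show "W \<in> node k U \<longleftrightarrow> W \<in> node k V"
      unfolding mem_node_iff using UV lattice_add lattice_diff by metis
  qed
qed

lemma nodes_eq_range: "nodes k = range (node k)"
  by (auto simp: nodes_def quotient_def node_def)

lemma node_add_cong: "node k U = node k V \<Longrightarrow> node k (U + S) = node k (V + S)"
  by (simp add: node_eq_iff)

text \<open>The representatives of an edge may be arbitrary, but translating the edge by a lattice
  vector moves its start to the chosen \<open>U\<close>.\<close>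

lemma adjacent_node_iff:
  "adjacent k (node k U) v \<longleftrightarrow> (\<exists>S. l1 S = 1 \<and> v = node k (U + S))"
proof
  assume "adjacent k (node k U) v"
  then obtain U' V' V where *: "U' \<in> node k U" "V' \<in> v" "v = node k V"
      "V' - U' \<in> {(1, 0), (-1, 0), (0, 1), (0, -1)}"
    by (auto simp: adjacent_def nodes_eq_range)
  have "node k U = node k U'" "v = node k V'"
    using * by (auto simp: mem_node_iff node_eq_iff)
  then have "v = node k (U + (V' - U'))"
    using node_add_cong[of k U U' "V' - U'"] by simp
  moreover have "l1 (V' - U') = 1" using *(4) by (auto simp only: l1_def) auto
  ultimately show "\<exists>S. l1 S = 1 \<and> v = node k (U + S)" by blast
next
  assume "\<exists>S. l1 S = 1 \<and> v = node k (U + S)"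
  then obtain S where S: "l1 S = 1" "v = node k (U + S)" by blast
  obtain x y where xy: "S = (x, y)" by (cases S)
  have "S \<in> {(1, 0), (-1, 0), (0, 1), (0, -1)}"
    using S(1) unfolding xy l1_def by simp presburger
  moreover have "U \<in> node k U" "U + S \<in> node k (U + S)"
    by (simp_all add: mem_node_iff lattice_zero)
  moreover have "(U + S) - U = S" by simp
  ultimately show "adjacent k (node k U) v"
    unfolding adjacent_def nodes_eq_range S(2) by (metis rangeI)
qed

lemma adjacent_pow_imp:
  "(adjacent k ^^ n) (node k U) v \<Longrightarrow> \<exists>D. l1 D \<le> int n \<and> v = node k (U + D)"
proof (induction n arbitrary: v)
  case 0
  then show ?case by (intro exI[of _ 0]) (auto simp: l1_def)
next
  case (Suc n)
  then obtain D where D: "l1 D \<le> int n" "adjacent k (node k (U + D)) v"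
    by fastforce
  then obtain S where "l1 S = 1" "v = node k (U + D + S)"
    by (auto simp: adjacent_node_iff)
  moreover have "l1 (D + S) \<le> l1 D + l1 S" by (simp add: l1_def)
  ultimately show ?case using D(1)
    by (intro exI[of _ "D + S"]) (simp add: add.assoc)
qed

text \<open>A nonzero coordinate is moved towards 0 by its sign, so the norm drops by exactly
  one.\<close>

lemma l1_stepE:
  assumes "l1 D = int (Suc n)"
  obtains D' S where "D = D' + S" "l1 D' = int n" "l1 S = 1"
proof (cases "fst D = 0")
  case True
  then have "l1 (0, snd D - sgn (snd D)) = int n" "l1 (0, sgn (snd D)) = 1"
    using assms by (auto simp: l1_def sgn_if)
  moreover have "D = (0, snd D - sgn (snd D)) + (0, sgn (snd D))"
    using True by (simp add: prod_eq_iff)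
  ultimately show ?thesis using that by blast
next
  case False
  then have "l1 (fst D - sgn (fst D), snd D) = int n" "l1 (sgn (fst D), 0) = 1"
    using assms by (auto simp: l1_def sgn_if)
  moreover have "D = (fst D - sgn (fst D), snd D) + (sgn (fst D), 0)"
    by (simp add: prod_eq_iff)
  ultimately show ?thesis using that by blast
qed

lemma adjacent_powI:
  "l1 D = int n \<Longrightarrow> (adjacent k ^^ n) (node k U) (node k (U + D))"
proof (induction n arbitrary: D)
  case 0
  then have "D = 0" by (auto simp: l1_def prod_eq_iff)
  then show ?case by simp
next
  case (Suc n)
  obtain D' S where D': "D = D' + S" "l1 D' = int n" "l1 S = 1"
    using l1_stepE[OF Suc.prems] .
  then have "(adjacent k ^^ n) (node k U) (node k (U + D'))" using Suc.IH by blast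
  moreover have "adjacent k (node k (U + D')) (node k (U + D))"
    unfolding adjacent_node_iff using D' by (metis add.assoc)
  ultimately show ?case by auto
qed

text \<open>A walk of length \<open>n\<close> displaces by a vector of norm at most
  \<open>n\<close>, and a displacement of norm \<open>n\<close> is realised by a walk of length
  \<open>n\<close>. A walk shorter than \<open>k\<close> would yield a vector of smaller norm
  congruent to \<open>Q\<close>, against uniqueness of representatives.\<close>

lemma graph_dist_eq_iff:
  "graph_dist k (node k U) (node k V) = k \<longleftrightarrow> (\<exists>Q\<in>boundary k. node k V = node k (U + Q))"
proof
  assume *: "graph_dist k (node k U) (node k V) = k"
  \<comment> \<open>Some walk exists, namely along \<open>V - U\<close>, so the \<open>LEAST\<close>
    in \<open>graph_dist\<close> is attained.\<close>
  have "(adjacent k ^^ nat (l1 (V - U))) (node k U) (node k (U + (V - U)))"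
    by (rule adjacent_powI) (simp add: l1_def)
  then have "(adjacent k ^^ k) (node k U) (node k V)"
    using * unfolding graph_dist_def by (metis LeastI add.commute diff_add_cancel)
  then obtain D where D: "l1 D \<le> int k" "node k V = node k (U + D)"
    using adjacent_pow_imp by blast
  have "(adjacent k ^^ nat (l1 D)) (node k U) (node k V)"
    unfolding D(2) by (rule adjacent_powI) (simp add: l1_def)
  then have "k \<le> nat (l1 D)"
    using * unfolding graph_dist_def by (metis Least_le)
  then have "D \<in> boundary k" using D(1) by (simp add: boundary_def l1_def)
  then show "\<exists>Q\<in>boundary k. node k V = node k (U + Q)" using D(2) by blast
next
  assume "\<exists>Q\<in>boundary k. node k V = node k (U + Q)"
  then obtain Q where Q: "l1 Q = int k" "node k V = node k (U + Q)"
    by (auto simp: boundary_def)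
  show "graph_dist k (node k U) (node k V) = k"
    unfolding graph_dist_def
  proof (rule Least_equality)
    show "(adjacent k ^^ k) (node k U) (node k V)"
      unfolding Q(2) by (rule adjacent_powI[OF Q(1)])
  next
    fix n assume "(adjacent k ^^ n) (node k U) (node k V)"
    then obtain D where D: "l1 D \<le> int n" "node k (U + Q) = node k (U + D)"
      using adjacent_pow_imp Q(2) by metis
    show "k \<le> n"
    proof (rule ccontr)
      assume "\<not> k \<le> n"
      moreover have "Q - D \<in> lattice k" using D(2) by (simp add: node_eq_iff)
      ultimately have "Q = D" using l1_lattice_le_eq[of Q D k] Q D by simp
      then show False using \<open>\<not> k \<le> n\<close> Q D by simp
    qed
  qed
qed

section \<open>Counting on the sides\<close>

definition side_union :: "nat \<Rightarrow> int \<times> int \<Rightarrow> nat \<Rightarrow> int set" where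
  "side_union k A i = (\<Union>L\<in>shift_set k. \<Union>j\<in>{1..4}. side_pair_set k i j A L)"

lemma atLeastAtMost_1_4: "{1..4} = {1, 2, 3, 4 :: nat}"
  by auto

lemma side_point_inj:
  assumes "t \<in> side_range k i" "u \<in> side_range k j" "i \<in> {1..4}" "j \<in> {1..4}"
    "side_point k i t = side_point k j u"
  shows "i = j \<and> t = u"
  using assms unfolding atLeastAtMost_1_4
  by (auto simp: side_point_def side_range_def)

lemma boundary_eq_sides: "boundary k = (\<Union>i\<in>{1..4}. side_point k i ` side_range k i)"
proof (intro set_eqI iffI)
  fix P assume P: "P \<in> boundary k"
  obtain x y where xy: "P = (x, y)" by (cases P)
  have *: "\<bar>x\<bar> + \<bar>y\<bar> = int k" using P xy by (simp add: boundary_def l1_def)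
  \<comment> \<open>The comparisons follow the half-open ranges: for positive \<open>k\<close> the
    corners \<open>(k, 0)\<close> and \<open>(0, k)\<close> go to side 1, \<open>(-k, 0)\<close> to
    side 2 and \<open>(0, -k)\<close> to side 3. On every side the parameter is the absolute value
    of the first coordinate.\<close>
  define i :: nat where
    "i = (if 0 \<le> x \<and> 0 \<le> y then 1 else if x < 0 \<and> 0 \<le> y then 2 else if x \<le> 0 then 3 else 4)"
  have "P = side_point k i \<bar>x\<bar>" "\<bar>x\<bar> \<in> side_range k i" "i \<in> {1..4}"
    using * by (auto simp: xy i_def side_point_def side_range_def)
  then show "P \<in> (\<Union>i\<in>{1..4}. side_point k i ` side_range k i)" by blast
next
  fix P assume "P \<in> (\<Union>i\<in>{1..4}. side_point k i ` side_range k i)"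
  then show "P \<in> boundary k" unfolding atLeastAtMost_1_4
    by (auto simp: boundary_def l1_def side_point_def side_range_def)
qed

lemma side_pair_set_subset: "side_pair_set k i j A L \<subseteq> {0..int k}"
  by (auto simp: side_pair_set_def side_range_def split: if_splits)

lemma finite_side_pair_set: "finite (side_pair_set k i j A L)"
  by (rule finite_subset[OF side_pair_set_subset]) simp

lemma card_side_pair_set_le: "card (side_pair_set k i j A L) \<le> k + 1"
  using card_mono[OF _ side_pair_set_subset, of k i j A L] by simp

lemma side_union_subset: "side_union k A i \<subseteq> side_range k i"
  by (auto simp: side_union_def side_pair_set_def)

lemma side_union_iff:
  "t \<in> side_union k A i \<longleftrightarrow> t \<in> side_range k i \<and>
     (\<exists>L\<in>shift_set k. \<exists>Q\<in>boundary k. side_point k i t = A + L + Q)"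
  unfolding side_union_def side_pair_set_def boundary_eq_sides by blast

lemma source_count_eq:
  assumes "0 < k" "A \<in> diamond k"
  shows "source_count A k = (\<Sum>i\<in>{1..4}. card (side_union k A i))"
proof -
  let ?B = "\<Union>i\<in>{1..4}. side_point k i ` side_union k A i"
  have B_sub: "?B \<subseteq> boundary k"
    unfolding boundary_eq_sides using side_union_subset by blast
  have "{P \<in> nodes k. graph_dist k (node k 0) P = k \<and> graph_dist k (node k A) P = k}
      = node k ` ?B" (is "?N = _")
  proof (intro equalityI subsetI)
    fix P assume P: "P \<in> ?N"
    then obtain V where V: "P = node k V" by (auto simp: nodes_eq_range)
    obtain R Q where R: "R \<in> boundary k" "P = node k R"
      and Q: "Q \<in> boundary k" "P = node k (A + Q)"
      using P graph_dist_eq_iff unfolding V by auto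
    \<comment> \<open>\<open>L\<close> compares the displacements that reach \<open>P\<close> from
      \<open>0\<close> and from \<open>A\<close>; three vectors of norm at most \<open>k\<close>
      bound its norm by \<open>3 k\<close>.\<close>
    define L where "L = R - (A + Q)"
    have "L \<in> lattice k" using R Q by (simp add: L_def flip: node_eq_iff)
    moreover have "l1 L \<le> l1 R + (l1 A + l1 Q)" by (simp add: L_def l1_def)
    then have "l1 L \<le> 3 * int k"
      using assms(2) R(1) Q(1) by (simp add: boundary_def mem_diamond_iff)
    ultimately have "L \<in> shift_set k" using assms(1) mem_shift_setI by blast
    obtain i t where it: "i \<in> {1..4}" "t \<in> side_range k i" "R = side_point k i t"
      using R(1) unfolding boundary_eq_sides by blast
    have "side_point k i t = A + L + Q" using it by (simp add: L_def)
    then have "t \<in> side_union k A i"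
      using side_union_iff it(2) \<open>L \<in> shift_set k\<close> Q(1) by blast
    then show "P \<in> node k ` ?B" using R(2) it by blast
  next
    fix P assume "P \<in> node k ` ?B"
    then obtain R where R: "P = node k R" "R \<in> ?B" by blast
    then obtain L Q where LQ: "L \<in> shift_set k" "Q \<in> boundary k" "R = A + L + Q"
      using side_union_iff by blast
    have "R \<in> boundary k" using R(2) B_sub by blast
    then have "graph_dist k (node k 0) P = k"
      unfolding R(1) graph_dist_eq_iff by auto
    moreover have "node k R = node k (A + Q)"
      using LQ shift_set_subset_lattice by (auto simp: node_eq_iff algebra_simps)
    then have "graph_dist k (node k A) P = k"
      using LQ(2) unfolding R(1) graph_dist_eq_iff by blast
    ultimately show "P \<in> ?N" using R(1) by (simp add: nodes_eq_range)
  qed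
  \<comment> \<open>Distinct boundary points represent distinct nodes, so points can be counted
    instead of nodes.\<close>
  moreover have "inj_on (node k) ?B"
  proof (rule inj_onI)
    fix P Q assume "P \<in> ?B" "Q \<in> ?B" and eq: "node k P = node k Q"
    then have "P \<in> boundary k" "Q \<in> boundary k" using B_sub by blast+
    then show "P = Q"
      using eq l1_lattice_le_eq[of P Q k] by (simp add: node_eq_iff boundary_def)
  qed
  ultimately have "source_count A k = card ?B"
    unfolding source_count_def by (simp add: card_image)
  also have "\<dots> = (\<Sum>i\<in>{1..4}. card (side_point k i ` side_union k A i))"
  proof (rule card_UN_disjoint)
    show "\<forall>i\<in>{1..4}. finite (side_point k i ` side_union k A i)"
      using finite_subset[OF side_union_subset] by (auto simp: side_range_def)
    show "\<forall>i\<in>{1..4}. \<forall>j\<in>{1..4}. i \<noteq> j \<longrightarrow>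
        side_point k i ` side_union k A i \<inter> side_point k j ` side_union k A j = {}"
      using side_point_inj side_union_subset by blast
  qed simp
  also have "\<dots> = (\<Sum>i\<in>{1..4}. card (side_union k A i))"
  proof (rule sum.cong[OF refl], rule card_image, rule inj_onI)
    fix i t u assume "i \<in> {1..4::nat}" "t \<in> side_union k A i" "u \<in> side_union k A i"
      "side_point k i t = side_point k i u"
    then show "t = u" using side_point_inj side_union_subset by blast
  qed
  finally show ?thesis .
qed

text \<open>Canonical representatives are unique, so for fixed \<open>i\<close> the sets \<open>T\<^sub>i\<^sub>j(A, L)\<close> are
  pairwise disjoint: merging the intervals amounts to adding their lengths.\<close>

lemma card_side_union:
  "card (side_union k A i) =
     (\<Sum>(j, m, n)\<in>{1..4} \<times> {-1, 0, 1} \<times> {-1, 0, 1}. card (side_pair_set k i j A (shift k m n)))"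
proof -
  let ?S = "{1..4::nat} \<times> {-1, 0, 1::int} \<times> {-1, 0, 1::int}"
  let ?T = "\<lambda>(j, m, n). side_pair_set k i j A (shift k m n)"
  have "side_union k A i = \<Union> (?T ` ?S)"
    unfolding side_union_def shift_set_image by fastforce
  moreover have "?T p \<inter> ?T q = {}" if "p \<in> ?S" "q \<in> ?S" "p \<noteq> q" for p q
  proof (rule ccontr)
    obtain j m n j' m' n' where pq: "p = (j, m, n)" "q = (j', m', n')"
      by (metis prod.exhaust)
    assume "?T p \<inter> ?T q \<noteq> {}"
    then obtain u u' where u: "u \<in> side_range k j" "u' \<in> side_range k j'"
      "A + shift k m n + side_point k j u = A + shift k m' n' + side_point k j' u'"
      unfolding pq side_pair_set_def by auto metis
    have jj: "j \<in> {1..4}" "j' \<in> {1..4}" using that pq by auto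
    \<comment> \<open>Both sums reach the same point of side \<open>i\<close>, so the two boundary
      points differ by a lattice vector and hence coincide.\<close>
    have eq: "side_point k j u - side_point k j' u' = shift k (m' - m) (n' - n)"
      using u(3) unfolding shift_diff[symmetric] by (simp add: algebra_simps)
    have "side_point k j u \<in> boundary k" "side_point k j' u' \<in> boundary k"
      unfolding boundary_eq_sides using u jj by blast+
    moreover have "side_point k j u - side_point k j' u' \<in> lattice k"
      unfolding eq by (auto simp: lattice_def)
    ultimately have *: "side_point k j u = side_point k j' u'"
      using l1_lattice_le_eq by (simp add: boundary_def)
    then have "j = j'" using side_point_inj u jj by blast
    moreover have "shift k (m' - m) (n' - n) = shift k 0 0" using eq * by simp
    then have "m = m' \<and> n = n'" unfolding shift_inj by simp
    ultimately show False using that(3) pq by simp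
  qed
  ultimately have "card (side_union k A i) = (\<Sum>p\<in>?S. card (?T p))"
    by (subst \<open>side_union k A i = _\<close>, intro card_UN_disjoint)
      (auto simp: finite_side_pair_set)
  then show ?thesis by (simp add: case_prod_beta')
qed

section \<open>Straight-line programs\<close>

definition fits_memory :: "nat \<Rightarrow> memory \<Rightarrow> bool" where
  "fits_memory w M \<longleftrightarrow> (\<forall>a. fits w (M a))"

lemma fits_memory_upd: "fits_memory w M \<Longrightarrow> fits w v \<Longrightarrow> fits_memory w (M(a := v))"
  by (simp add: fits_memory_def)

text \<open>Indirect addressing and jumps are excluded, so \<open>address_ok\<close> always holds
  and the program counter always advances by one.\<close>

fun direct :: "instr \<Rightarrow> bool" where
  "direct (Load a b) = False"
| "direct (Store a b) = False"
| "direct (Jump_Less a b l) = False"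
| "direct _ = True"

text \<open>Execution without a program counter, which makes it compositional under concatenation of
  code.\<close>

fun runs :: "nat \<Rightarrow> program \<Rightarrow> memory \<Rightarrow> memory \<Rightarrow> bool" where
  "runs w [] M M' \<longleftrightarrow> M' = M"
| "runs w (x # xs) M M' \<longleftrightarrow> direct x \<and> fits_memory w (snd (effect x (0, M))) \<and>
     runs w xs (snd (effect x (0, M))) M'"

lemma runs_append: "runs w (xs @ ys) M M' \<longleftrightarrow> (\<exists>M\<^sub>1. runs w xs M M\<^sub>1 \<and> runs w ys M\<^sub>1 M')"
  by (induction xs arbitrary: M) auto

lemma direct_effect:
  "direct x \<Longrightarrow> address_ok x M \<and> effect x (pc, M) = (Suc pc, snd (effect x (0, M)))"
  by (cases x) auto

text \<open>The prefix \<open>xs\<close> stands for code already executed. It is arbitrary so that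
  the induction can move each executed instruction into it while the whole program stays
  fixed.\<close>

lemma runs_ram_steps:
  "runs w ys M M' \<Longrightarrow>
     (ram_step w (xs @ ys) ^^ length ys) (length xs, M) (length xs + length ys, M')"
proof (induction ys arbitrary: xs M)
  case (Cons y ys)
  let ?M = "snd (effect y (0, M))"
  have "ram_step w (xs @ y # ys) (length xs, M) (Suc (length xs), ?M)"
    using Cons.prems direct_effect[of y M "length xs"] by (simp add: ram_step_def fits_memory_def)
  moreover have "(ram_step w (xs @ y # ys) ^^ length ys) (Suc (length xs), ?M)
      (length xs + length (y # ys), M')"
    using Cons.IH[of ?M "xs @ [y]"] Cons.prems by simp
  ultimately show ?case
    unfolding list.size(4) add_Suc_right add_0_right by (rule relpowp_Suc_I2)
qed auto

lemma runs_ram_halts: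
  "runs w p M M' \<Longrightarrow> fits_memory w M \<Longrightarrow> ram_halts w p M (length p) M'"
  using runs_ram_steps[of w p M M' "[]"] by (auto simp: ram_halts_def fits_memory_def)

section \<open>A stack compiler for arithmetic expressions\<close>

datatype binop = Plus | Minus | Times | Quot | Lt

datatype expr = Num int | Cell nat | Bin binop expr expr

fun apply_op :: "binop \<Rightarrow> int \<Rightarrow> int \<Rightarrow> int" where
  "apply_op Plus x y = x + y"
| "apply_op Minus x y = x - y"
| "apply_op Times x y = x * y"
| "apply_op Quot x y = x div y"
| "apply_op Lt x y = (if x < y then 1 else 0)"

fun op_instr :: "binop \<Rightarrow> nat \<Rightarrow> nat \<Rightarrow> nat \<Rightarrow> instr" where
  "op_instr Plus = Add"
| "op_instr Minus = Sub"
| "op_instr Times = Mult"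
| "op_instr Quot = Div"
| "op_instr Lt = Less"

fun val :: "memory \<Rightarrow> expr \<Rightarrow> int" where
  "val M (Num v) = v"
| "val M (Cell a) = M a"
| "val M (Bin f d e) = apply_op f (val M d) (val M e)"

fun cells_below :: "nat \<Rightarrow> expr \<Rightarrow> bool" where
  "cells_below r (Num v) \<longleftrightarrow> True"
| "cells_below r (Cell a) \<longleftrightarrow> a < r"
| "cells_below r (Bin f d e) \<longleftrightarrow> cells_below r d \<and> cells_below r e"

fun safe :: "nat \<Rightarrow> memory \<Rightarrow> expr \<Rightarrow> bool" where
  "safe w M (Num v) \<longleftrightarrow> fits w v"
| "safe w M (Cell a) \<longleftrightarrow> True"
| "safe w M (Bin f d e) \<longleftrightarrow> safe w M d \<and> safe w M e \<and> fits w (val M (Bin f d e))"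

text \<open>Here \<open>r\<close> is the stack top: the left operand stays in cell \<open>r\<close>
  while the right one is computed in cell \<open>Suc r\<close>, and the result replaces the left
  operand.\<close>

fun compile :: "nat \<Rightarrow> expr \<Rightarrow> program" where
  "compile r (Num v) = [Const r v]"
| "compile r (Cell a) = [Copy r a]"
| "compile r (Bin f d e) = compile r d @ compile (Suc r) e @ [op_instr f r r (Suc r)]"

lemma val_cong: "cells_below r e \<Longrightarrow> (\<And>a. a < r \<Longrightarrow> M a = M' a) \<Longrightarrow> val M e = val M' e"
  by (induction e) auto

lemma safe_cong:
  assumes "cells_below r e" "\<And>a. a < r \<Longrightarrow> M a = M' a"
  shows "safe w M e = safe w M' e"
  using assms(1)
proof (induction e)
  case (Bin f d e)
  moreover have "val M d = val M' d" "val M e = val M' e"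
    using Bin.prems assms(2) by (auto intro: val_cong)
  ultimately show ?case by simp
qed auto

lemma cells_below_mono: "cells_below r e \<Longrightarrow> r \<le> s \<Longrightarrow> cells_below s e"
  by (induction e) auto

lemma runs_op_instr:
  "fits_memory w M \<Longrightarrow> fits w (apply_op f (M b) (M c)) \<Longrightarrow>
     runs w [op_instr f a b c] M (M(a := apply_op f (M b) (M c)))"
  by (cases f) (auto intro: fits_memory_upd)

text \<open>The code writes only to cells from \<open>r\<close> on, while expressions read only
  cells below \<open>r\<close>. Evaluating the left operand therefore does not disturb the right
  one, and the left result survives the evaluation of the right operand.\<close>

lemma compile_correct:
  assumes "cells_below r e" "safe w M e" "fits_memory w M"
  shows "\<exists>M'. runs w (compile r e) M M' \<and> fits_memory w M' \<and> M' r = val M e \<and>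
    (\<forall>a<r. M' a = M a)"
  using assms
proof (induction e arbitrary: r M)
  case (Num v)
  then show ?case by (auto intro: fits_memory_upd)
next
  case (Cell a)
  then have "fits_memory w (M(r := M a))" by (simp add: fits_memory_def)
  then show ?case by auto
next
  case (Bin f d e)
  have below: "cells_below (Suc r) e" using Bin.prems(1) cells_below_mono[of r e] by simp
  obtain M\<^sub>1 where M\<^sub>1: "runs w (compile r d) M M\<^sub>1" "fits_memory w M\<^sub>1" "M\<^sub>1 r = val M d"
      "\<forall>a<r. M\<^sub>1 a = M a"
    using Bin.IH(1)[of r M] Bin.prems by auto
  have e: "val M\<^sub>1 e = val M e" "safe w M\<^sub>1 e"
    using Bin.prems M\<^sub>1(4) val_cong[of r e M\<^sub>1 M] safe_cong[of r e M\<^sub>1 M] by auto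
  obtain M\<^sub>2 where M\<^sub>2: "runs w (compile (Suc r) e) M\<^sub>1 M\<^sub>2" "fits_memory w M\<^sub>2"
      "M\<^sub>2 (Suc r) = val M e" "\<forall>a<Suc r. M\<^sub>2 a = M\<^sub>1 a"
    using Bin.IH(2)[OF below e(2) M\<^sub>1(2)] e(1) by auto
  have r: "M\<^sub>2 r = val M d" using M\<^sub>2(4) M\<^sub>1(3) by simp
  let ?v = "apply_op f (M\<^sub>2 r) (M\<^sub>2 (Suc r))"
  have v: "?v = val M (Bin f d e)" using r M\<^sub>2(3) by simp
  then have "fits w ?v" using Bin.prems(2) by simp
  then have "runs w [op_instr f r r (Suc r)] M\<^sub>2 (M\<^sub>2(r := ?v))" "fits_memory w (M\<^sub>2(r := ?v))"
    using M\<^sub>2(2) runs_op_instr fits_memory_upd by blast+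
  moreover from this(1) have "runs w (compile r (Bin f d e)) M (M\<^sub>2(r := ?v))"
    unfolding compile.simps runs_append using M\<^sub>1(1) M\<^sub>2(1) by blast
  moreover have "(M\<^sub>2(r := ?v)) r = val M (Bin f d e)" using v by simp
  moreover have "\<forall>a<r. (M\<^sub>2(r := ?v)) a = M a" using M\<^sub>1(4) M\<^sub>2(4) by simp
  ultimately show ?case by blast
qed

text \<open>Expressions are evaluated on a stack that starts above all cells in use.\<close>

definition stack_base :: nat where
  "stack_base = 1000"

definition assign :: "nat \<Rightarrow> expr \<Rightarrow> program" where
  "assign d e = compile stack_base e @ [Copy d stack_base]"

text \<open>Cells from \<open>stack_base\<close> on are scratch space whose final contents are left
  open.\<close>

definition below_stack_eq :: "memory \<Rightarrow> memory \<Rightarrow> bool" where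
  "below_stack_eq M M' \<longleftrightarrow> (\<forall>a<stack_base. M a = M' a)"

lemma assign_correct:
  assumes "cells_below stack_base e" "safe w M e" "fits_memory w M"
  shows "\<exists>M'. runs w (assign d e) M M' \<and> fits_memory w M' \<and>
    below_stack_eq M' (M(d := val M e))"
proof -
  obtain M\<^sub>1 where M\<^sub>1: "runs w (compile stack_base e) M M\<^sub>1" "fits_memory w M\<^sub>1"
    "M\<^sub>1 stack_base = val M e" "\<forall>a<stack_base. M\<^sub>1 a = M a"
    using compile_correct[OF assms] by blast
  have "fits_memory w (M\<^sub>1(d := M\<^sub>1 stack_base))" using M\<^sub>1(2) by (simp add: fits_memory_def)
  then show ?thesis
    unfolding assign_def runs_append
    by (intro exI[of _ "M\<^sub>1(d := M\<^sub>1 stack_base)"]) (use M\<^sub>1 in \<open>auto simp: below_stack_eq_def\<close>)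
qed

section \<open>Bounds on intermediate results\<close>

text \<open>An exponent for a bound \<open>b ^ deg e\<close> when all cells are bounded by
  \<open>b\<close>. For a constant it relies on \<open>v \<le> 2 ^ v\<close>; for an operation the
  exponents add up as for a product, and the extra 1 absorbs the factor 2 of a sum.\<close>

fun deg :: "expr \<Rightarrow> nat" where
  "deg (Num v) = nat \<bar>v\<bar>"
| "deg (Cell a) = 1"
| "deg (Bin f d e) = deg d + deg e + 1"

text \<open>Negating both arguments makes the divisor positive, and monotonicity in the divisor then
  compares with \<open>x div 1 = x\<close>. Division by 0 yields 0.\<close>

lemma abs_div_le: "\<bar>x div y\<bar> \<le> \<bar>x :: int\<bar>"
proof (cases "y = 0")
  case False
  have *: "\<bar>x div y\<bar> \<le> \<bar>x\<bar>" if "0 < y" for x y :: int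
  proof (cases "0 \<le> x")
    case True
    then show ?thesis using that zdiv_mono2[of x 1 y] pos_imp_zdiv_nonneg_iff[of y x] by simp
  next
    case False
    then show ?thesis
      using that zdiv_mono2_neg[of x 1 y] pos_imp_zdiv_neg_iff[of y x] by simp
  qed
  show ?thesis
  proof (cases "0 < y")
    case False
    then show ?thesis using *[of "- y" "- x"] \<open>y \<noteq> 0\<close> by simp
  qed (use * in simp)
qed simp

lemma abs_apply_op_le:
  assumes "\<bar>x\<bar> \<le> b ^ m" "\<bar>y\<bar> \<le> b ^ n" "2 \<le> (b :: int)"
  shows "\<bar>apply_op f x y\<bar> \<le> b ^ (m + n + 1)"
proof -
  have 1: "1 \<le> b ^ m" "1 \<le> b ^ n" using assms(3) by simp_all
  then have "b ^ m * 1 \<le> b ^ m * b ^ n" "1 * b ^ n \<le> b ^ m * b ^ n"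
    by (intro mult_mono; simp)+
  then have mn: "b ^ m \<le> b ^ m * b ^ n" "b ^ n \<le> b ^ m * b ^ n" by simp_all
  have "2 * (b ^ m * b ^ n) \<le> b * (b ^ m * b ^ n)"
    using assms(3) 1 by (intro mult_right_mono) auto
  then have two: "2 * (b ^ m * b ^ n) \<le> b ^ (m + n + 1)" by (simp add: power_add mult.commute)
  obtain B where B: "B = b ^ (m + n + 1)" by blast
  have "\<bar>x * y\<bar> \<le> b ^ m * b ^ n"
    unfolding abs_mult using assms by (intro mult_mono) auto
  then have "\<bar>x + y\<bar> \<le> B" "\<bar>x - y\<bar> \<le> B" "\<bar>x * y\<bar> \<le> B" "\<bar>x div y\<bar> \<le> B" "1 \<le> B"
    using assms(1,2) mn two 1 abs_div_le[of x y] unfolding B by linarith+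
  then show ?thesis unfolding B[symmetric] by (cases f) auto
qed

text \<open>The gap between \<open>d\<close> and \<open>c\<close> leaves a spare factor
  \<open>b\<close>, which exceeds the factor 2 in the definition of \<open>fits\<close>.\<close>

lemma fits_power:
  assumes "\<bar>v\<bar> \<le> b ^ d" "d < c" "5 \<le> (b :: int)" "b ^ c \<le> 2 ^ w"
  shows "fits w v"
proof -
  have "1 \<le> b ^ d" using assms(3) by simp
  then have "2 * b ^ d < b * b ^ d" using assms(3) by (intro mult_strict_right_mono) auto
  also have "\<dots> = b ^ Suc d" by simp
  also have "\<dots> \<le> b ^ c" using assms by (intro power_increasing) auto
  finally show ?thesis using assms unfolding fits_def by auto
qed

lemma abs_le_power_self: "2 \<le> b \<Longrightarrow> \<bar>v\<bar> \<le> (b :: int) ^ nat \<bar>v\<bar>"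
proof -
  assume b: "2 \<le> b"
  have "\<bar>v\<bar> = int (nat \<bar>v\<bar>)" by simp
  also have "\<dots> \<le> int (2 ^ nat \<bar>v\<bar>)" using less_exp less_imp_le of_nat_le_iff by metis
  also have "\<dots> \<le> b ^ nat \<bar>v\<bar>" using b by (simp add: power_mono)
  finally show ?thesis .
qed

text \<open>Subexpressions have smaller degree, so a single bound on the degree of the whole
  expression makes every intermediate result fit.\<close>

lemma val_le_deg_and_safe:
  assumes b: "5 \<le> (b :: int)" "b ^ c \<le> 2 ^ w" and "cells_below r e" "\<And>a. a < r \<Longrightarrow> \<bar>M a\<bar> \<le> b"
    and "deg e < c"
  shows "\<bar>val M e\<bar> \<le> b ^ deg e \<and> safe w M e"
  using assms(3,5)
proof (induction e)
  case (Num v)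
  have "\<bar>v\<bar> \<le> b ^ nat \<bar>v\<bar>" using b abs_le_power_self[of b v] by simp
  then show ?case using Num fits_power[of v b "nat \<bar>v\<bar>" c w] b by auto
next
  case (Cell a)
  then show ?case using assms(4) by simp
next
  case (Bin f d e)
  then have "\<bar>val M (Bin f d e)\<bar> \<le> b ^ deg (Bin f d e)"
    using abs_apply_op_le[of "val M d" b "deg d" "val M e" "deg e" f] b by simp
  then show ?case using Bin fits_power[OF _ Bin.prems(2) b] by auto
qed

section \<open>Solving the linear equations\<close>

text \<open>Side \<open>i\<close> is \<open>(sgn_x i * t, sgn_y i * (k - t))\<close> for \<open>first i \<le> t \<le> k - gap i\<close>.\<close>

definition sgn_x :: "nat \<Rightarrow> int" where "sgn_x i = (if i \<in> {1, 4} then 1 else -1)"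
definition sgn_y :: "nat \<Rightarrow> int" where "sgn_y i = (if i \<in> {1, 2} then 1 else -1)"
definition first :: "nat \<Rightarrow> int" where "first i = (if i \<in> {1, 3} then 0 else 1)"
definition gap :: "nat \<Rightarrow> int" where "gap i = (if i \<in> {1, 2} then 0 else 1)"

abbreviation add_expr (infixl "\<oplus>" 65) where "d \<oplus> e \<equiv> Bin Plus d e"
abbreviation diff_expr (infixl "\<ominus>" 65) where "d \<ominus> e \<equiv> Bin Minus d e"
abbreviation mult_expr (infixl "\<otimes>" 70) where "d \<otimes> e \<equiv> Bin Times d e"
abbreviation less_expr (infix "\<prec>" 50) where "d \<prec> e \<equiv> Bin Lt d e"
abbreviation half_expr where "half_expr e \<equiv> Bin Quot e (Num 2)"

text \<open>The comparison result 0 or 1 serves as a multiplier, which replaces a conditional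
  jump.\<close>

definition max_expr :: "expr \<Rightarrow> expr \<Rightarrow> expr" where
  "max_expr d e = d \<oplus> (d \<prec> e) \<otimes> (e \<ominus> d)"

definition min_expr :: "expr \<Rightarrow> expr \<Rightarrow> expr" where
  "min_expr d e = e \<oplus> (d \<prec> e) \<otimes> (d \<ominus> e)"

lemma val_max_expr [simp]: "val M (max_expr d e) = max (val M d) (val M e)"
  by (simp add: max_expr_def max_def)

lemma val_min_expr [simp]: "val M (min_expr d e) = min (val M d) (val M e)"
  by (simp add: min_expr_def min_def)

lemma cells_below_max_min [simp]:
  "cells_below r (max_expr d e) \<longleftrightarrow> cells_below r d \<and> cells_below r e"
  "cells_below r (min_expr d e) \<longleftrightarrow> cells_below r d \<and> cells_below r e"
  by (auto simp: max_expr_def min_expr_def)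

text \<open>With \<open>(X, Y) = A + m e\<^sub>1 + n e\<^sub>2\<close> and signs \<open>\<alpha> = sgn_x i * sgn_x j\<close>,
  \<open>\<beta> = sgn_y i * sgn_y j\<close>, the two equations become \<open>t - \<alpha> u = x\<close> and \<open>t - \<beta> u = z\<close>, where
  \<open>x = sgn_x i * X\<close> and \<open>z = k - sgn_y i * Y - \<beta> k\<close>.  The first one turns the range of \<open>u\<close>
  into a range of \<open>t\<close>.  If \<open>\<alpha> = \<beta>\<close>, the second one reads \<open>x = z\<close>, otherwise \<open>2 t = x + z\<close>.\<close>

definition x_expr :: "nat \<Rightarrow> int \<Rightarrow> int \<Rightarrow> expr" where
  "x_expr i m n =
     Num (sgn_x i) \<otimes> (Cell 1 \<oplus> (Num m \<otimes> Cell 0 \<ominus> Num n \<otimes> (Cell 0 \<oplus> Num 1)))"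

definition z_expr :: "nat \<Rightarrow> nat \<Rightarrow> int \<Rightarrow> int \<Rightarrow> expr" where
  "z_expr i j m n =
     Cell 0 \<ominus> Num (sgn_y i) \<otimes> (Cell 2 \<oplus> (Num m \<otimes> (Cell 0 \<oplus> Num 1) \<oplus> Num n \<otimes> Cell 0))
       \<ominus> Num (sgn_y i * sgn_y j) \<otimes> Cell 0"

definition low_expr :: "nat \<times> nat \<times> int \<times> int \<Rightarrow> expr" where
  "low_expr = (\<lambda>(i, j, m, n). let x = x_expr i m n; z = z_expr i j m n;
     l = max_expr (Num (first i))
       (if sgn_x i = sgn_x j then x \<oplus> Num (first j) else x \<ominus> (Cell 0 \<ominus> Num (gap j)))
     in if sgn_x i * sgn_x j = sgn_y i * sgn_y j then l
        else max_expr l (half_expr (x \<oplus> z \<oplus> Num 1)))"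

text \<open>For equal signs and \<open>x \<noteq> z\<close> exactly one of the two comparisons gives
  1, so the upper end, at most \<open>k\<close>, drops by \<open>k + 1\<close> below 0 and the
  interval becomes empty without a jump.\<close>

definition high_expr :: "nat \<times> nat \<times> int \<times> int \<Rightarrow> expr" where
  "high_expr = (\<lambda>(i, j, m, n). let x = x_expr i m n; z = z_expr i j m n;
     h = min_expr (Cell 0 \<ominus> Num (gap i))
       (if sgn_x i = sgn_x j then x \<oplus> (Cell 0 \<ominus> Num (gap j)) else x \<ominus> Num (first j))
     in if sgn_x i * sgn_x j = sgn_y i * sgn_y j
        then h \<ominus> ((x \<prec> z) \<oplus> (z \<prec> x)) \<otimes> (Cell 0 \<oplus> Num 1)
        else min_expr h (half_expr (x \<oplus> z)))"

definition has_input :: "nat \<Rightarrow> int \<times> int \<Rightarrow> memory \<Rightarrow> bool" where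
  "has_input k A M \<longleftrightarrow> M 0 = int k \<and> M 1 = fst A \<and> M 2 = snd A"

text \<open>The lower end rounds up and the upper end rounds down, so an odd \<open>a\<close> leaves
  the interval empty. This is the parity condition on \<open>x + z\<close>.\<close>

lemma half_interval:
  fixes a t :: int
  shows "(a + 1) div 2 \<le> t \<and> t \<le> a div 2 \<longleftrightarrow> 2 * t = a"
  by presburger

lemma sgn_cases: "sgn_x i = 1 \<or> sgn_x i = -1" "sgn_y i = 1 \<or> sgn_y i = -1"
  by (auto simp: sgn_x_def sgn_y_def)

lemma side_point_sgn:
  "i \<in> {1..4} \<Longrightarrow> side_point k i t = (sgn_x i * t, sgn_y i * (int k - t))"
  unfolding atLeastAtMost_1_4 by (auto simp: side_point_def sgn_x_def sgn_y_def)

lemma side_range_first_gap: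
  "i \<in> {1..4} \<Longrightarrow> side_range k i = {first i..int k - gap i}"
  unfolding atLeastAtMost_1_4 by (auto simp: side_range_def first_def gap_def)

lemma first_gap_nonneg: "0 \<le> first i" "0 \<le> gap i"
  by (simp_all add: first_def gap_def)

text \<open>The signs are their own inverses, so the first equation can be solved for
  \<open>u\<close>. Substituting this into the second cancels \<open>t\<close> when the two sign
  products agree and doubles it when they are opposite.\<close>

lemma side_equations:
  assumes "i \<in> {1..4}" "j \<in> {1..4}"
  shows "side_point k i t = (X, Y) + side_point k j u \<longleftrightarrow>
    u = sgn_x i * sgn_x j * (t - sgn_x i * X) \<and>
    (if sgn_x i * sgn_x j = sgn_y i * sgn_y j
     then sgn_x i * X = int k - sgn_y i * Y - sgn_y i * sgn_y j * int k
     else 2 * t = sgn_x i * X + (int k - sgn_y i * Y - sgn_y i * sgn_y j * int k))"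
  unfolding side_point_sgn[OF assms(1)] side_point_sgn[OF assms(2)]
  using sgn_cases[of i] sgn_cases[of j]
  by (elim disjE) (simp; arith)+

lemma side_pair_set_eq_interval:
  assumes "i \<in> {1..4}" "j \<in> {1..4}" "has_input k A M"
  shows "side_pair_set k i j A (shift k m n) =
    {val M (low_expr (i, j, m, n))..val M (high_expr (i, j, m, n))}"
proof (intro set_eqI)
  fix t
  obtain X Y where XY: "A + shift k m n = (X, Y)" by fastforce
  have *: "fst A + (m * int k - n * (int k + 1)) = X"
    "snd A + (m * (int k + 1) + n * int k) = Y"
    using XY by (auto simp: shift_def prod_eq_iff)
  define x where "x = sgn_x i * X"
  define z where "z = int k - sgn_y i * Y - sgn_y i * sgn_y j * int k"
  have x: "val M (x_expr i m n) = x"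
    using assms(3) unfolding x_def *(1)[symmetric] by (simp add: x_expr_def has_input_def)
  have z: "val M (z_expr i j m n) = z"
    using assms(3) unfolding z_def *(2)[symmetric] by (simp add: z_expr_def has_input_def)
  have M0: "M 0 = int k" using assms(3) by (simp add: has_input_def)
  have "t \<in> side_pair_set k i j A (shift k m n) \<longleftrightarrow>
      first i \<le> t \<and> t \<le> int k - gap i \<and>
      first j \<le> sgn_x i * sgn_x j * (t - x) \<and> sgn_x i * sgn_x j * (t - x) \<le> int k - gap j \<and>
      (if sgn_x i * sgn_x j = sgn_y i * sgn_y j then x = z else 2 * t = x + z)"
    unfolding side_pair_set_def XY mem_Collect_eq side_equations[OF assms(1,2)]
      side_range_first_gap[OF assms(1)] side_range_first_gap[OF assms(2)] x_def[symmetric]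
      z_def[symmetric] by auto
  \<comment> \<open>If the sign product is -1, the inequalities for \<open>u\<close> reverse, which
    exchanges the two ends of its range.\<close>
  also have "\<dots> \<longleftrightarrow> first i \<le> t \<and> t \<le> int k - gap i \<and>
      (if sgn_x i = sgn_x j then x + first j else x - (int k - gap j)) \<le> t \<and>
      t \<le> (if sgn_x i = sgn_x j then x + (int k - gap j) else x - first j) \<and>
      (if sgn_x i * sgn_x j = sgn_y i * sgn_y j then x = z else 2 * t = x + z)"
    using sgn_cases(1)[of i] sgn_cases(1)[of j] by (elim disjE) (simp; linarith)+
  also have "\<dots> \<longleftrightarrow> val M (low_expr (i, j, m, n)) \<le> t \<and> t \<le> val M (high_expr (i, j, m, n))"
  proof (cases "sgn_x i * sgn_x j = sgn_y i * sgn_y j")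
    case True
    show ?thesis
    proof (cases "x = z")
      case True
      then show ?thesis using \<open>sgn_x i * sgn_x j = _\<close>
        by (simp add: low_expr_def high_expr_def Let_def x z M0 if_distrib[of "val M"] conj_ac)
    next
      case False
      have "\<not> (val M (low_expr (i, j, m, n)) \<le> t \<and> t \<le> val M (high_expr (i, j, m, n)))"
        using False \<open>sgn_x i * sgn_x j = _\<close> first_gap_nonneg[of i]
        by (auto simp: low_expr_def high_expr_def Let_def x z M0 if_distrib[of "val M"] min_def)
      then show ?thesis using False \<open>sgn_x i * sgn_x j = _\<close> by simp
    qed
  next
    case False
    then show ?thesis using half_interval[of "x + z" t]
      by (auto simp: low_expr_def high_expr_def Let_def x z M0 if_distrib[of "val M"])
  qed
  finally show "t \<in> side_pair_set k i j A (shift k m n) \<longleftrightarrow>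
    t \<in> {val M (low_expr (i, j, m, n))..val M (high_expr (i, j, m, n))}" by simp
qed

section \<open>The programs\<close>

definition jmn_list :: "(nat \<times> int \<times> int) list" where
  "jmn_list = List.product [1..<5] (List.product [-1, 0, 1] [-1, 0, 1])"

definition index_list :: "(nat \<times> nat \<times> int \<times> int) list" where
  "index_list = List.product [1..<5] jmn_list"

text \<open>A mixed-radix number, with \<open>m\<close> and \<open>n\<close> as balanced ternary
  digits. On the 144 indices it lies between 50 and 220, so the cells derived from it avoid cells 0
  to 4, reserved for inputs and results, and the stack.\<close>

definition pair_code :: "nat \<times> nat \<times> int \<times> int \<Rightarrow> nat" where
  "pair_code = (\<lambda>(i, j, m, n). nat (45 * int i + 9 * int j + 3 * m + n))"

definition low :: "nat \<times> nat \<times> int \<times> int \<Rightarrow> nat" where "low p = 2 * pair_code p"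
definition high :: "nat \<times> nat \<times> int \<times> int \<Rightarrow> nat" where "high p = 2 * pair_code p + 1"

lemma set_jmn_list: "set jmn_list = {1..4} \<times> {-1, 0, 1} \<times> {-1, 0, 1}"
  by (auto simp: jmn_list_def)

lemma set_index_list: "set index_list = {1..4} \<times> {1..4} \<times> {-1, 0, 1} \<times> {-1, 0, 1}"
  by (auto simp: index_list_def set_jmn_list)

lemma distinct_jmn_list: "distinct jmn_list"
  unfolding jmn_list_def by (intro distinct_product) auto

lemma distinct_index_list: "distinct index_list"
  unfolding index_list_def by (intro distinct_product distinct_jmn_list) auto

lemma length_jmn_list: "length jmn_list = 36"
  by (simp add: jmn_list_def)

text \<open>The lower digits contribute at most 35 against weight 45, at most 8 against weight 9 and
  at most 2 against weight 3, so the digits vanish from the leading one down.\<close>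

lemma mixed_radix_zero:
  fixes a b c d :: int
  assumes "45 * a + 9 * b + 3 * c + d = 0" "\<bar>b\<bar> \<le> 3" "\<bar>c\<bar> \<le> 2" "\<bar>d\<bar> \<le> 2"
  shows "a = 0 \<and> b = 0 \<and> c = 0 \<and> d = 0"
proof -
  have "a = 0" using assms by linarith
  moreover from this have "b = 0" using assms by linarith
  moreover from calculation have "c = 0" using assms by linarith
  ultimately show ?thesis using assms by linarith
qed

lemma pair_code_inj:
  assumes "p \<in> set index_list" "q \<in> set index_list" "pair_code p = pair_code q"
  shows "p = q"
proof -
  have *: "{-1, 0, 1} = {-1..1 :: int}" by auto
  obtain i j m n i' j' m' n' where pq: "p = (i, j, m, n)" "q = (i', j', m', n')"
    by (metis prod.exhaust)
  have p: "1 \<le> i" "1 \<le> j" "j \<le> 4" "-1 \<le> m" "m \<le> 1" "-1 \<le> n" "n \<le> 1"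
    using assms(1) unfolding set_index_list pq * by auto
  have q: "1 \<le> i'" "1 \<le> j'" "j' \<le> 4" "-1 \<le> m'" "m' \<le> 1" "-1 \<le> n'" "n' \<le> 1"
    using assms(2) unfolding set_index_list pq * by auto
  have "45 * int i + 9 * int j + 3 * m + n = 45 * int i' + 9 * int j' + 3 * m' + n'"
    using assms(3) p q by (simp add: pair_code_def pq eq_nat_nat_iff)
  then have "45 * (int i - int i') + 9 * (int j - int j') + 3 * (m - m') + (n - n') = 0"
    by simp
  moreover have "\<bar>int j - int j'\<bar> \<le> 3" "\<bar>m - m'\<bar> \<le> 2" "\<bar>n - n'\<bar> \<le> 2"
    using p q by auto
  ultimately have "int i - int i' = 0 \<and> int j - int j' = 0 \<and> m - m' = 0 \<and> n - n' = 0"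
    by (rule mixed_radix_zero)
  then show ?thesis by (simp add: pq)
qed

lemma cell_bounds:
  assumes "p \<in> set index_list"
  shows "5 \<le> low p" "low p < stack_base" "5 \<le> high p" "high p < stack_base"
  using assms by (auto simp: set_index_list low_def high_def pair_code_def stack_base_def)

lemma cell_distinct:
  "low p \<noteq> high q"
  "p \<in> set index_list \<Longrightarrow> q \<in> set index_list \<Longrightarrow> low p = low q \<longleftrightarrow> p = q"
  "p \<in> set index_list \<Longrightarrow> q \<in> set index_list \<Longrightarrow> high p = high q \<longleftrightarrow> p = q"
  using pair_code_inj[of p q] unfolding low_def high_def by (presburger, auto)

definition pair_comp :: "nat \<times> nat \<times> int \<times> int \<Rightarrow> side_pair_comp" where
  "pair_comp p = Side_Pair_Comp p
     (assign (low p) (low_expr p) @ assign (high p) (high_expr p)) (low p) (high p)"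

lemma pair_comp_sel [simp]:
  "pair_index (pair_comp p) = p" "lo_cell (pair_comp p) = low p" "hi_cell (pair_comp p) = high p"
  by (simp_all add: pair_comp_def)

text \<open>The flag suppresses the difference of the end points of an empty interval, which need not
  fit into a word.\<close>

definition len_expr :: "nat \<times> nat \<times> int \<times> int \<Rightarrow> expr" where
  "len_expr p = (let f = Num 1 \<ominus> (Cell (high p) \<prec> Cell (low p))
     in f \<otimes> Cell (high p) \<ominus> f \<otimes> Cell (low p) \<oplus> f)"

definition sum_expr :: "expr list \<Rightarrow> expr" where
  "sum_expr es = foldr add_expr es (Num 0)"

definition side_expr :: "nat \<Rightarrow> expr" where
  "side_expr i = sum_expr (map (\<lambda>p. len_expr (i, p)) jmn_list)"

definition merge_sides :: "nat list \<Rightarrow> program" where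
  "merge_sides is = concat (map (\<lambda>i. assign i (side_expr i)) is)"

definition merge_program :: program where
  "merge_program = merge_sides [1..<5] @ assign 0 (sum_expr (map Cell [1..<5]))"

text \<open>The sum dominates the degree of each single end point, and 40 covers the exponents 1 and
  4 used for inputs, lengths and sums. As an exponent of the network order it asks for words of a
  fixed multiple of \<open>log N\<close> bits.\<close>

definition word_exponent :: nat where
  "word_exponent =
     40 + sum_list (map (\<lambda>p. deg (low_expr p) + deg (high_expr p)) index_list)"

lemma deg_less_word_exponent:
  assumes "p \<in> set index_list"
  shows "deg (low_expr p) < word_exponent" "deg (high_expr p) < word_exponent"
proof -
  have "deg (low_expr p) + deg (high_expr p) \<le>
      sum_list (map (\<lambda>p. deg (low_expr p) + deg (high_expr p)) index_list)"
    using assms by (intro member_le_sum_list) auto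
  then show "deg (low_expr p) < word_exponent" "deg (high_expr p) < word_exponent"
    by (simp_all add: word_exponent_def)
qed

lemma cells_below_low_high_expr: "cells_below 3 (low_expr p)" "cells_below 3 (high_expr p)"
  by (cases p; simp add: low_expr_def high_expr_def x_expr_def z_expr_def Let_def)+

text \<open>The order is the base of all size bounds: \<open>fits_power\<close> asks for at least 5,
  the value at \<open>k = 1\<close>, and \<open>k + 1\<close> bounds the coordinates and the
  interval lengths.\<close>

lemma network_order_bounds:
  assumes "0 < k"
  shows "5 \<le> int (network_order k)" "int k + 1 \<le> int (network_order k)"
proof -
  have "1 \<le> k\<^sup>2" "2\<^sup>2 \<le> (k + 1)\<^sup>2" "1 * (k + 1) \<le> (k + 1)\<^sup>2"
    using assms by (simp, intro power_mono, simp_all add: power2_eq_square)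
  then have "5 \<le> network_order k" "k + 1 \<le> network_order k"
    unfolding network_order_def by auto
  then show "5 \<le> int (network_order k)" "int k + 1 \<le> int (network_order k)" by simp_all
qed

lemma determines_comp:
  "determines k A (pair_comp (i, j, m, n)) M \<longleftrightarrow>
     side_pair_set k i j A (shift k m n) = {M (low (i, j, m, n))..M (high (i, j, m, n))}"
  by (simp add: determines_def)

lemma determines_comp_cong:
  "M (low p) = M' (low p) \<Longrightarrow> M (high p) = M' (high p) \<Longrightarrow>
     determines k A (pair_comp p) M \<longleftrightarrow> determines k A (pair_comp p) M'"
  by (simp add: determines_def)

section \<open>Correctness of the programs for sufficiently long words\<close>

locale word_size =
  fixes k :: nat and A :: "int \<times> int" and w :: nat
  assumes k_pos: "0 < k" and A_diamond: "A \<in> diamond k"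
    and w: "network_order k ^ word_exponent \<le> 2 ^ w"
begin

lemma base_power_le: "int (network_order k) ^ word_exponent \<le> 2 ^ w"
  using w by (metis of_nat_le_iff of_nat_numeral of_nat_power)

lemma input_bounds:
  assumes "has_input k A M" "a < 3"
  shows "\<bar>M a\<bar> \<le> int k"
proof -
  have "a = 0 \<or> a = 1 \<or> a = 2" using assms(2) by linarith
  then show ?thesis
    using assms(1) A_diamond by (auto simp: has_input_def mem_diamond_iff l1_def)
qed

lemma safe_low_high_expr:
  assumes "p \<in> set index_list" "has_input k A M"
  shows "safe w M (low_expr p)" "safe w M (high_expr p)"
proof -
  have M: "\<bar>M a\<bar> \<le> int (network_order k)" if "a < 3" for a
    using input_bounds[OF assms(2) that] network_order_bounds(2)[OF k_pos] by linarith
  note * = val_le_deg_and_safe[OF network_order_bounds(1)[OF k_pos] base_power_le, of 3 _ M]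
  show "safe w M (low_expr p)" "safe w M (high_expr p)"
    using *[OF cells_below_low_high_expr(1) M] *[OF cells_below_low_high_expr(2) M]
      deg_less_word_exponent[OF assms(1)] by blast+
qed

lemma comp_correct:
  assumes p: "p \<in> set index_list" and M: "has_input k A M" "fits_memory w M"
  shows "\<exists>M'. runs w (pair_program (pair_comp p)) M M' \<and> fits_memory w M' \<and> has_input k A M' \<and>
    determines k A (pair_comp p) M' \<and>
    (\<forall>a<stack_base. a \<noteq> low p \<longrightarrow> a \<noteq> high p \<longrightarrow> M' a = M a)"
proof -
  have below: "cells_below stack_base (low_expr p)" "cells_below stack_base (high_expr p)"
    using cells_below_low_high_expr[of p] cells_below_mono[of 3 _ stack_base]
    by (simp_all add: stack_base_def)
  have inp: "has_input k A N" if "\<forall>a<5. N a = M a" for N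
    using M(1) that by (simp add: has_input_def)
  note b = cell_bounds[OF p]
  obtain M\<^sub>1 where M\<^sub>1: "runs w (assign (low p) (low_expr p)) M M\<^sub>1" "fits_memory w M\<^sub>1"
      "below_stack_eq M\<^sub>1 (M(low p := val M (low_expr p)))"
    using assign_correct[OF below(1) safe_low_high_expr(1)[OF p M(1)] M(2)] by blast
  have *: "M\<^sub>1 a = (M(low p := val M (low_expr p))) a" if "a < stack_base" for a
    using M\<^sub>1(3) that by (simp add: below_stack_eq_def)
  have i\<^sub>1: "has_input k A M\<^sub>1" using * b by (intro inp) (auto simp: stack_base_def)
  obtain M\<^sub>2 where M\<^sub>2: "runs w (assign (high p) (high_expr p)) M\<^sub>1 M\<^sub>2" "fits_memory w M\<^sub>2"
      "below_stack_eq M\<^sub>2 (M\<^sub>1(high p := val M\<^sub>1 (high_expr p)))"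
    using assign_correct[OF below(2) safe_low_high_expr(2)[OF p i\<^sub>1] M\<^sub>1(2)] by blast
  have **: "M\<^sub>2 a = (M\<^sub>1(high p := val M\<^sub>1 (high_expr p))) a" if "a < stack_base" for a
    using M\<^sub>2(3) that by (simp add: below_stack_eq_def)
  have i\<^sub>2: "has_input k A M\<^sub>2" using * ** b by (intro inp) (auto simp: stack_base_def)
  \<comment> \<open>Storing the lower end leaves the input cells alone, so the upper end is computed
    from the original input.\<close>
  have "M a = M\<^sub>1 a" if "a < 3" for a using * b that by (simp add: stack_base_def)
  then have "val M\<^sub>1 (high_expr p) = val M (high_expr p)"
    using val_cong[OF cells_below_low_high_expr(2)] by metis
  then have "M\<^sub>2 (low p) = val M (low_expr p)" "M\<^sub>2 (high p) = val M (high_expr p)"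
    using * ** b cell_distinct(1)[of p p] by auto
  then have "determines k A (pair_comp p) M\<^sub>2"
    using side_pair_set_eq_interval[OF _ _ M(1)] p
    by (cases p) (auto simp: determines_comp set_index_list)
  moreover have "runs w (pair_program (pair_comp p)) M M\<^sub>2"
    using M\<^sub>1(1) M\<^sub>2(1) by (auto simp: pair_comp_def runs_append)
  ultimately show ?thesis using M\<^sub>2(2) i\<^sub>2 * ** by auto
qed

text \<open>The last clause is a frame condition: it carries the end points found by one computation
  unchanged through all later ones.\<close>

lemma run_comps_correct:
  assumes "set ps \<subseteq> set index_list" "distinct ps" "has_input k A M" "fits_memory w M"
  shows "\<exists>M'. run_comps w k A (map pair_comp ps) M
      (sum_list (map (\<lambda>p. length (pair_program (pair_comp p))) ps)) M' \<and>
    (\<forall>p\<in>set ps. determines k A (pair_comp p) M') \<and>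
    (\<forall>q\<in>set index_list - set ps. M' (low q) = M (low q) \<and> M' (high q) = M (high q))"
  using assms
proof (induction ps arbitrary: M)
  case (Cons p ps)
  have p: "p \<in> set index_list" "p \<notin> set ps" using Cons.prems by auto
  obtain M\<^sub>1 where M\<^sub>1: "runs w (pair_program (pair_comp p)) M M\<^sub>1" "fits_memory w M\<^sub>1"
      "has_input k A M\<^sub>1" "determines k A (pair_comp p) M\<^sub>1"
      "\<forall>a<stack_base. a \<noteq> low p \<longrightarrow> a \<noteq> high p \<longrightarrow> M\<^sub>1 a = M a"
    using comp_correct[OF p(1) Cons.prems(3,4)] by blast
  obtain M' where M': "run_comps w k A (map pair_comp ps) M\<^sub>1
        (sum_list (map (\<lambda>p. length (pair_program (pair_comp p))) ps)) M'"
      "\<forall>p\<in>set ps. determines k A (pair_comp p) M'"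
      "\<forall>q\<in>set index_list - set ps. M' (low q) = M\<^sub>1 (low q) \<and> M' (high q) = M\<^sub>1 (high q)"
    using Cons.IH[OF _ _ M\<^sub>1(3,2)] Cons.prems by auto
  have "ram_halts w (pair_program (pair_comp p)) M (length (pair_program (pair_comp p))) M\<^sub>1"
    using runs_ram_halts M\<^sub>1(1) Cons.prems(4) by blast
  then have "run_comps w k A (map pair_comp (p # ps)) M
      (sum_list (map (\<lambda>p. length (pair_program (pair_comp p))) (p # ps))) M'"
    using M\<^sub>1(4) M'(1) by auto
  moreover have "determines k A (pair_comp p) M'"
    using M\<^sub>1(4) M'(3) p determines_comp_cong[of M' p M\<^sub>1] by blast
  moreover have "M' (low q) = M (low q) \<and> M' (high q) = M (high q)"
    if "q \<in> set index_list - set (p # ps)" for q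
  proof -
    have "q \<in> set index_list" "q \<noteq> p" using that by auto
    then have "M\<^sub>1 (low q) = M (low q)" "M\<^sub>1 (high q) = M (high q)"
      using M\<^sub>1(5) cell_bounds cell_distinct p(1) by metis+
    then show ?thesis using M'(3) that by simp
  qed
  ultimately show ?case using M'(2) by (intro exI[of _ M'] conjI) auto
qed simp

lemma fits_input_memory: "fits_memory w (input_memory k A)"
proof -
  have "\<bar>input_memory k A a\<bar> \<le> int (network_order k) ^ 1" for a
    using A_diamond network_order_bounds(2)[OF k_pos]
    by (auto simp: input_memory_def mem_diamond_iff l1_def)
  then show ?thesis
    unfolding fits_memory_def
    using fits_power[OF _ _ network_order_bounds(1)[OF k_pos] base_power_le, of _ 1]
    by (simp add: word_exponent_def)
qed

lemma has_input_input_memory: "has_input k A (input_memory k A)"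
  by (simp add: has_input_def input_memory_def)

text \<open>All that merging may rely on. The input cells are left out because the counts of sides 1
  and 2 overwrite the coordinates of \<open>A\<close>.\<close>

definition ready :: "memory \<Rightarrow> bool" where
  "ready M \<longleftrightarrow> fits_memory w M \<and> (\<forall>p\<in>set index_list. determines k A (pair_comp p) M)"

lemma fits_le_network_order: "\<bar>v\<bar> \<le> int (network_order k) \<Longrightarrow> fits w v"
  using fits_power[of v "int (network_order k)" 1 word_exponent w]
    network_order_bounds(1)[OF k_pos] base_power_le by (simp add: word_exponent_def)

lemma len_expr_correct:
  assumes "ready M" "(i, j, m, n) \<in> set index_list"
  shows "val M (len_expr (i, j, m, n)) = int (card (side_pair_set k i j A (shift k m n)))"
    "safe w M (len_expr (i, j, m, n))"
proof -
  let ?p = "(i, j, m, n)" and ?T = "side_pair_set k i j A (shift k m n)"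
  have T: "?T = {M (low ?p)..M (high ?p)}"
    using assms by (auto simp: ready_def determines_comp)
  then show v: "val M (len_expr ?p) = int (card ?T)"
    by (simp add: len_expr_def Let_def)
  have small: "fits w x" if "\<bar>x\<bar> \<le> int k + 1" for x
    using that network_order_bounds(2)[OF k_pos] by (intro fits_le_network_order) linarith
  have "fits w (M a)" for a using assms(1) by (simp add: ready_def fits_memory_def)
  moreover have "int (card ?T) \<le> int k + 1"
    using card_side_pair_set_le[of k i j A "shift k m n"] by linarith
  ultimately show "safe w M (len_expr ?p)"
    using small v T by (auto simp: len_expr_def Let_def)
qed

lemma val_sum_expr: "val M (sum_expr es) = sum_list (map (val M) es)"
  by (induction es) (simp_all add: sum_expr_def)

lemma safe_sum_expr:
  assumes "\<And>e. e \<in> set es \<Longrightarrow> safe w M e \<and> 0 \<le> val M e \<and> val M e \<le> int (network_order k)"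
    "length es \<le> 36"
  shows "safe w M (sum_expr es) \<and> 0 \<le> val M (sum_expr es) \<and>
    val M (sum_expr es) \<le> int (length es) * int (network_order k)"
  using assms
proof (induction es)
  case Nil
  then show ?case using fits_le_network_order[of 0] by (simp add: sum_expr_def)
next
  case (Cons e es)
  let ?b = "int (network_order k)"
  have IH: "safe w M (sum_expr es)" "0 \<le> val M (sum_expr es)"
      "val M (sum_expr es) \<le> int (length es) * ?b"
    using Cons.IH Cons.prems by auto
  have e: "safe w M e" "0 \<le> val M e" "val M e \<le> ?b" using Cons.prems by auto
  have le: "val M e + val M (sum_expr es) \<le> int (length (e # es)) * ?b"
    using IH(3) e(3) by (simp add: algebra_simps)
  have b: "5 \<le> ?b" using network_order_bounds(1)[OF k_pos] .
  \<comment> \<open>The list of intervals for one side has length 36, and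
    \<open>36 \<le> 5 ^ 3\<close>, so every partial sum stays below the fourth power of the network
    order.\<close>
  have "int (length (e # es)) * ?b \<le> 36 * ?b"
    using Cons.prems(2) b by (intro mult_right_mono) auto
  also have "\<dots> \<le> ?b ^ 3 * ?b"
    using power_mono[OF b, of 3] b by (intro mult_right_mono) auto
  also have "\<dots> = ?b ^ 4" by (simp add: eval_nat_numeral)
  finally have "\<bar>val M e + val M (sum_expr es)\<bar> \<le> ?b ^ 4" using le IH(2) e(2) by linarith
  then have "fits w (val M e + val M (sum_expr es))"
    by (rule fits_power[OF _ _ b base_power_le]) (simp add: word_exponent_def)
  then show ?case using IH e le by (simp add: sum_expr_def)
qed

lemma side_expr_correct:
  assumes "ready M" "i \<in> {1..4}"
  shows "val M (side_expr i) = int (card (side_union k A i))" "safe w M (side_expr i)"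
proof -
  have p: "(i, p) \<in> set index_list" if "p \<in> set jmn_list" for p
    using that assms(2) by (auto simp: set_index_list set_jmn_list)
  have len: "val M (len_expr (i, p)) =
      int (case p of (j, m, n) \<Rightarrow> card (side_pair_set k i j A (shift k m n)))"
    if "p \<in> set jmn_list" for p
    using len_expr_correct(1)[OF assms(1)] p[OF that] by (cases p) auto
  have "val M (side_expr i) = sum_list (map (\<lambda>p. val M (len_expr (i, p))) jmn_list)"
    unfolding side_expr_def val_sum_expr map_map o_def ..
  also have "\<dots> = (\<Sum>p\<in>set jmn_list. val M (len_expr (i, p)))"
    using distinct_jmn_list by (simp add: sum_list_distinct_conv_sum_set)
  also have "\<dots> = int (card (side_union k A i))"
    unfolding card_side_union of_nat_sum set_jmn_list[symmetric] using len by (intro sum.cong) auto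
  finally show "val M (side_expr i) = int (card (side_union k A i))" .
  have "0 \<le> val M (len_expr (i, p)) \<and> val M (len_expr (i, p)) \<le> int (network_order k)
      \<and> safe w M (len_expr (i, p))" if "p \<in> set jmn_list" for p
  proof -
    obtain j m n where jmn: "p = (j, m, n)" by (metis prod.exhaust)
    have "card (side_pair_set k i j A (shift k m n)) \<le> k + 1" by (rule card_side_pair_set_le)
    then show ?thesis
      using len_expr_correct[OF assms(1) p[OF that, unfolded jmn]] network_order_bounds(2)[OF k_pos]
      unfolding jmn by simp
  qed
  then show "safe w M (side_expr i)"
    unfolding side_expr_def using safe_sum_expr[of "map (\<lambda>p. len_expr (i, p)) jmn_list" M]
    by (fastforce simp: length_jmn_list)
qed

lemma cells_below_sum_expr: "cells_below r (sum_expr es) \<longleftrightarrow> (\<forall>e\<in>set es. cells_below r e)"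
  by (induction es) (auto simp: sum_expr_def)

lemma cells_below_side_expr:
  assumes "i \<in> {1..4}"
  shows "cells_below stack_base (side_expr i)"
proof -
  have "(i, p) \<in> set index_list" if "p \<in> set jmn_list" for p
    using that assms by (auto simp: set_index_list set_jmn_list)
  then show ?thesis using cell_bounds
    by (auto simp: side_expr_def cells_below_sum_expr len_expr_def Let_def)
qed

text \<open>The counts go to cells 1 to 4, below all end-point cells, so \<open>ready\<close>
  persists from one side to the next.\<close>

lemma merge_sides_correct:
  assumes "ready M" "set is \<subseteq> {1..4}" "distinct is"
  shows "\<exists>M'. runs w (merge_sides is) M M' \<and> fits_memory w M' \<and>
    (\<forall>i\<in>set is. M' i = int (card (side_union k A i))) \<and>
    (\<forall>a<stack_base. a \<notin> set is \<longrightarrow> M' a = M a)"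
  using assms
proof (induction "is" arbitrary: M)
  case Nil
  then show ?case by (auto simp: merge_sides_def ready_def)
next
  case (Cons i js)
  have i: "i \<in> {1..4}" using Cons.prems by simp
  have "fits_memory w M" using Cons.prems(1) by (simp add: ready_def)
  then obtain M\<^sub>1 where M\<^sub>1: "runs w (assign i (side_expr i)) M M\<^sub>1" "fits_memory w M\<^sub>1"
      "below_stack_eq M\<^sub>1 (M(i := int (card (side_union k A i))))"
    using assign_correct[OF cells_below_side_expr[OF i]] side_expr_correct[OF Cons.prems(1) i]
    by metis
  have *: "M\<^sub>1 a = (M(i := int (card (side_union k A i)))) a" if "a < stack_base" for a
    using M\<^sub>1(3) that by (simp add: below_stack_eq_def)
  have "determines k A (pair_comp p) M\<^sub>1" if "p \<in> set index_list" for p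
  proof -
    have "M\<^sub>1 (low p) = M (low p)" "M\<^sub>1 (high p) = M (high p)"
      using *[of "low p"] *[of "high p"] cell_bounds[OF that] i by auto
    then show ?thesis
      using Cons.prems(1) that determines_comp_cong[of M\<^sub>1 p M] by (simp add: ready_def)
  qed
  then have "ready M\<^sub>1" using M\<^sub>1(2) by (simp add: ready_def)
  then obtain M' where M': "runs w (merge_sides js) M\<^sub>1 M'" "fits_memory w M'"
      "\<forall>i\<in>set js. M' i = int (card (side_union k A i))"
      "\<forall>a<stack_base. a \<notin> set js \<longrightarrow> M' a = M\<^sub>1 a"
    using Cons.IH[OF \<open>ready M\<^sub>1\<close>] Cons.prems by force
  have "i < stack_base" using i by (simp add: stack_base_def)
  then have "M' i = int (card (side_union k A i))" using M'(4) * Cons.prems(3) by auto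
  moreover have "runs w (merge_sides (i # js)) M M'"
    using M\<^sub>1(1) M'(1) by (auto simp: merge_sides_def runs_append)
  ultimately show ?case using M' * by (intro exI[of _ M']) auto
qed

lemma merge_program_correct:
  assumes "ready M"
  shows "\<exists>M'. runs w merge_program M M' \<and>
    (\<forall>i\<in>{1..4}. M' i = int (card (side_union k A i))) \<and> M' 0 = int (source_count A k)"
proof -
  let ?e = "sum_expr (map Cell [1..<5])"
  have set: "set [1..<5] = {1..4::nat}" by auto
  obtain M\<^sub>1 where M\<^sub>1: "runs w (merge_sides [1..<5]) M M\<^sub>1" "fits_memory w M\<^sub>1"
      "\<forall>i\<in>{1..4}. M\<^sub>1 i = int (card (side_union k A i))"
    using merge_sides_correct[OF assms, of "[1..<5]"] unfolding set by auto
  \<comment> \<open>Each side has at most \<open>k + 1\<close> parameters; this bounds the summands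
    of the final addition.\<close>
  have "card (side_union k A i) \<le> network_order k" for i
  proof -
    have "side_union k A i \<subseteq> {0..int k}"
      using side_pair_set_subset unfolding side_union_def by fast
    then have "card (side_union k A i) \<le> k + 1" using card_mono[of "{0..int k}" "side_union k A i"] by simp
    then show ?thesis using network_order_bounds(2)[OF k_pos] by linarith
  qed
  then have "safe w M\<^sub>1 e \<and> 0 \<le> val M\<^sub>1 e \<and> val M\<^sub>1 e \<le> int (network_order k)"
    if "e \<in> set (map Cell [1..<5])" for e
    using that M\<^sub>1(3) unfolding set_map set by auto
  then have "safe w M\<^sub>1 ?e" using safe_sum_expr[of "map Cell [1..<5]" M\<^sub>1] by simp
  moreover have "cells_below stack_base ?e"
    by (auto simp: cells_below_sum_expr stack_base_def)
  ultimately obtain M\<^sub>2 where M\<^sub>2: "runs w (assign 0 ?e) M\<^sub>1 M\<^sub>2"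
      "below_stack_eq M\<^sub>2 (M\<^sub>1(0 := val M\<^sub>1 ?e))"
    using assign_correct M\<^sub>1(2) by blast
  have *: "M\<^sub>2 a = (M\<^sub>1(0 := val M\<^sub>1 ?e)) a" if "a < stack_base" for a
    using M\<^sub>2(2) that by (simp add: below_stack_eq_def)
  have "val M\<^sub>1 ?e = (\<Sum>i\<in>{1..4}. M\<^sub>1 i)"
    unfolding val_sum_expr set[symmetric] by (simp add: o_def sum_list_distinct_conv_sum_set)
  also have "\<dots> = int (source_count A k)"
    using M\<^sub>1(3) source_count_eq[OF k_pos A_diamond] by simp
  finally have "M\<^sub>2 0 = int (source_count A k)" using *[of 0] by (simp add: stack_base_def)
  moreover have "\<forall>i\<in>{1..4}. M\<^sub>2 i = int (card (side_union k A i))"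
    using M\<^sub>1(3) * by (auto simp: stack_base_def)
  moreover have "runs w merge_program M M\<^sub>2"
    using M\<^sub>1(1) M\<^sub>2(1) by (auto simp: merge_program_def runs_append)
  ultimately show ?thesis by blast
qed

end

text \<open>The programs, their cells, \<open>c\<close> and \<open>C\<close> are quantified before
  \<open>k\<close>, \<open>A\<close> and \<open>w\<close>, which expresses the fixed number of
  computations and the constant running time. Merging has to work on every fitting memory with the
  right end points, so its results come from the intervals alone.\<close>

theorem theorem1:
  shows "(\<forall>k A. 0 < k \<longrightarrow> A \<in> diamond k \<longrightarrow>
            source_count A k =
              (\<Sum>i\<in>{1..4}. card (\<Union>L\<in>shift_set k. \<Union>j\<in>{1..4}. side_pair_set k i j A L)))
    \<and> (\<exists>(comps :: side_pair_comp list) (merge :: program) (side_cell :: nat \<Rightarrow> nat)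
          (out_cell :: nat) (c :: nat) (C :: nat).
         distinct (map pair_index comps) \<and>
         set (map pair_index comps) = {1..4} \<times> {1..4} \<times> {-1, 0, 1} \<times> {-1, 0, 1} \<and>
         (\<forall>k. 0 < k \<longrightarrow>
            card (({1..4} :: nat set) \<times> ({1..4} :: nat set) \<times> shift_set k) = length comps) \<and>
         (\<forall>k A w. 0 < k \<longrightarrow> A \<in> diamond k \<longrightarrow> network_order k ^ c \<le> 2 ^ w \<longrightarrow>
            (\<exists>t\<^sub>1 M\<^sub>1.
               run_comps w k A comps (input_memory k A) t\<^sub>1 M\<^sub>1 \<and>
               (\<forall>q\<in>set comps. determines k A q M\<^sub>1) \<and>
               (\<forall>M. (\<forall>a. fits w (M a)) \<longrightarrow> (\<forall>q\<in>set comps. determines k A q M) \<longrightarrow>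
                  (\<exists>t\<^sub>2 M\<^sub>2.
                     ram_halts w merge M t\<^sub>2 M\<^sub>2 \<and>
                     (\<forall>i\<in>{1..4}. M\<^sub>2 (side_cell i) =
                        int (card (\<Union>L\<in>shift_set k. \<Union>j\<in>{1..4}. side_pair_set k i j A L))) \<and>
                     M\<^sub>2 out_cell = int (source_count A k) \<and>
                     t\<^sub>1 + t\<^sub>2 \<le> C)))))"
proof (rule conjI)
  show "\<forall>k A. 0 < k \<longrightarrow> A \<in> diamond k \<longrightarrow> source_count A k =
      (\<Sum>i\<in>{1..4}. card (\<Union>L\<in>shift_set k. \<Union>j\<in>{1..4}. side_pair_set k i j A L))"
    using source_count_eq unfolding side_union_def by blast
next
  let ?comps = "map pair_comp index_list"
  let ?t = "sum_list (map (\<lambda>p. length (pair_program (pair_comp p))) index_list)"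
  have index: "map pair_index ?comps = index_list" by (simp add: o_def)
  have card: "card (({1..4} :: nat set) \<times> ({1..4} :: nat set) \<times> shift_set k) = length ?comps" for k
    by (simp add: card_cartesian_product card_shift_set index_list_def length_jmn_list)
  show "\<exists>comps merge side_cell out_cell c C.
         distinct (map pair_index comps) \<and>
         set (map pair_index comps) = {1..4} \<times> {1..4} \<times> {-1, 0, 1} \<times> {-1, 0, 1} \<and>
         (\<forall>k. 0 < k \<longrightarrow>
            card (({1..4} :: nat set) \<times> ({1..4} :: nat set) \<times> shift_set k) = length comps) \<and>
         (\<forall>k A w. 0 < k \<longrightarrow> A \<in> diamond k \<longrightarrow> network_order k ^ c \<le> 2 ^ w \<longrightarrow>
            (\<exists>t\<^sub>1 M\<^sub>1.
               run_comps w k A comps (input_memory k A) t\<^sub>1 M\<^sub>1 \<and>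
               (\<forall>q\<in>set comps. determines k A q M\<^sub>1) \<and>
               (\<forall>M. (\<forall>a. fits w (M a)) \<longrightarrow> (\<forall>q\<in>set comps. determines k A q M) \<longrightarrow>
                  (\<exists>t\<^sub>2 M\<^sub>2.
                     ram_halts w merge M t\<^sub>2 M\<^sub>2 \<and>
                     (\<forall>i\<in>{1..4}. M\<^sub>2 (side_cell i) =
                        int (card (\<Union>L\<in>shift_set k. \<Union>j\<in>{1..4}. side_pair_set k i j A L))) \<and>
                     M\<^sub>2 out_cell = int (source_count A k) \<and>
                     t\<^sub>1 + t\<^sub>2 \<le> C))))"
  \<comment> \<open>Side \<open>i\<close> is counted in cell \<open>i\<close> and the total in cell
    0. The programs are jump-free, so the time bound is their total length.\<close>
  proof (rule exI[of _ ?comps], rule exI[of _ merge_program], rule exI[of _ "\<lambda>i. i"],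
      rule exI[of _ 0], rule exI[of _ word_exponent], rule exI[of _ "?t + length merge_program"],
      intro conjI allI impI, goal_cases)
    case 1
    show ?case unfolding index by (rule distinct_index_list)
  next
    case 2
    show ?case unfolding index by (rule set_index_list)
  next
    case 3
    show ?case by (rule card)
  next
    case (4 k A w)
    then interpret word_size k A w by unfold_locales
    obtain M\<^sub>1 where M\<^sub>1: "run_comps w k A ?comps (input_memory k A) ?t M\<^sub>1"
        "\<forall>p\<in>set index_list. determines k A (pair_comp p) M\<^sub>1"
      using run_comps_correct[OF subset_refl distinct_index_list has_input_input_memory
          fits_input_memory] by blast
    show ?case
    proof (rule exI[of _ ?t], rule exI[of _ M\<^sub>1], intro conjI allI impI, goal_cases)
      case 1
      show ?case by (rule M\<^sub>1(1))
    next
      case 2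
      show ?case using M\<^sub>1(2) by simp
    next
      case (3 M)
      then have M: "ready M" by (simp add: ready_def fits_memory_def)
      obtain M\<^sub>2 where M\<^sub>2: "runs w merge_program M M\<^sub>2"
          "\<forall>i\<in>{1..4}. M\<^sub>2 i = int (card (side_union k A i))"
          "M\<^sub>2 0 = int (source_count A k)"
        using merge_program_correct[OF M] by blast
      have "ram_halts w merge_program M (length merge_program) M\<^sub>2"
        using M\<^sub>2(1) M by (simp add: runs_ram_halts ready_def)
      then show ?case
        using M\<^sub>2(2,3) unfolding side_union_def
        by (intro exI[of _ "length merge_program"] exI[of _ M\<^sub>2] conjI) (assumption | rule order_refl)+
    qed
  qed
qed

end
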